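(* Let $m\ge1$ be an integer, $\rho>0$, and let $n_0\ge0$ be an integer. Let $N(t)$ be the Erlang A process with $\eta=0$ (the $M/M/m$ queue) and $N(0)=n_0$, let $p_n(t)=\mathrm{Prob}[N(t)=n\mid N(0)=n_0]$ and $\widehat P_n(\theta)=\int_0^\infty e^{-\theta t}p_n(t)\,dt$ for $\mathrm{Re}(\theta)>0$. Set $$A=A(\theta)=\frac1{2m}\left[m+\rho+\theta-\sqrt{(m+\rho+\theta)^2-4m\rho}\right],\qquad B=B(\theta)=\frac1{2m}\left[m+\rho+\theta+\sqrt{(m+\rho+\theta)^2-4m\rho}\right].$$ Write $F_n=F_n(\theta)$, $G_n=G_n(\theta)$. If $0\le n_0\le m$, then $$\widehat P_n(\theta)=\frac{n_0!}{m!}\rho^{m-n_0}\frac{F_{n_0}A^{n-m}}{(m+1)F_{m+1}-A\,mF_m},\qquad n\ge m,$$ $$\widehat P_n(\theta)=\frac{n_0!\,\Gamma(\theta)e^{-\rho}}{\rho^{n_0+\theta}}\left[G_n+\frac{mA\,G_m-(m+1)G_{m+1}}{(m+1)F_{m+1}-mA\,F_m}F_n\right]F_{n_0},\qquad n_0\le n\le m,$$ $$\widehat P_n(\theta)=\frac{n_0!\,\Gamma(\theta)e^{-\rho}}{\rho^{n_0+\theta}}\left[G_{n_0}+\frac{mA\,G_m-(m+1)G_{m+1}}{(m+1)F_{m+1}-mA\,F_m}F_{n_0}\right]F_n,\qquad 0\le n\le n_0.$$ If $n_0\ge m$, then $$\widehat P_n(\theta)=B^{m-n_0}\frac{F_n}{(m+1)F_{m+1}-Am\,F_m},\qquad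 0\le n\le m,$$ $$\widehat P_n(\theta)=\frac{1}{\sqrt{(m+\rho+\theta)^2-4m\rho}}\left[B^{n-n_0}+A^{n-m}B^{m-n_0}\frac{(m+1)F_{m+1}-Bm\,F_m}{Am\,F_m-(m+1)F_{m+1}}\right],\qquad m\le n\le n_0,$$ $$\widehat P_n(\theta)=\frac{1}{\sqrt{(m+\rho+\theta)^2-4m\rho}}\left[A^{n-n_0}+B^{m-n_0}A^{n-m}\frac{(m+1)F_{m+1}-Bm\,F_m}{Am\,F_m-(m+1)F_{m+1}}\right],\qquad n\ge n_0.$$
   Context: With service rate $\mu=1$ and $\eta=0$, $N(t)$ is the birth–death process on $\{0,1,2,\dots\}$ with birth rate $\rho$ in every state and death rate $\min\{n,m\}$ in state $n$. The square root is the branch analytic in $\mathrm{Re}(\theta)>0$ that is positive for $\theta>0$. Special functions (for integer $n$): $$F_n(\theta)=\frac{1}{2\pi i}\int_{C_0}\frac{e^{\rho z}}{z^{n+1}(1-z)^\theta}\,dz,\qquad G_n(\theta)=\frac{1}{2\pi i}\int_{C_1}\frac{e^{\rho z}}{z^{n+1}(z-1)^\theta}\,dz,$$ where $C_0$ is a small counterclockwise circle about $0$ inside $|z|<1$; $C_1$ goes from $-\infty-i\varepsilon$ to $-\infty+i\varepsilon$ ($\varepsilon>0$), encircling $z=1$ counterclockwise and avoiding $\{\mathrm{Im}(z)=0,\mathrm{Re}(z)\le1\}$. Branches: $(1-z)^\theta=|1-z|^\theta e^{i\theta\arg(1-z)}$ with $|\arg(1-z)|<\pi$, and $(z-1)^\theta=|z-1|^\theta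 e^{i\theta\arg(z-1)}$ with $|\arg(z-1)|<\pi$. $\Gamma$ is the Gamma function. *)

theory Defs
  imports "HOL-Probability.Probability" "HOL-Complex_Analysis.Complex_Analysis"
begin

definition birth_death_rate :: "(nat \<Rightarrow> real) \<Rightarrow> (nat \<Rightarrow> real) \<Rightarrow> nat \<Rightarrow> nat \<Rightarrow> real" where
  "birth_death_rate birth death i j =
     (if j = Suc i then birth i
      else if i = Suc j then death i
      else if i = j then - (birth i + (if i = 0 then 0 else death i))
      else 0)"

text \<open>Stochasticity of the transition matrices is built into the type of probability mass functions;
  the second equation is Chapman-Kolmogorov.\<close>

definition transition_semigroup :: "(real \<Rightarrow> 'a \<Rightarrow> 'a pmf) \<Rightarrow> bool" where
  "transition_semigroup P \<longleftrightarrow>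
     P 0 = return_pmf \<and>
     (\<forall>s\<ge>0. \<forall>t\<ge>0. \<forall>i. P (s + t) i = bind_pmf (P s i) (P t))"

definition has_transition_rates ::
    "(real \<Rightarrow> 'a \<Rightarrow> 'a pmf) \<Rightarrow> ('a \<Rightarrow> 'a \<Rightarrow> real) \<Rightarrow> bool" where
  "has_transition_rates P q \<longleftrightarrow>
     (\<forall>i j. ((\<lambda>h. (pmf (P h i) j - pmf (P 0 i) j) / h) \<longlongrightarrow> q i j) (at_right 0))"

text \<open>The Markov property, with respect to the whole past observed at finitely many times, for a
  process indexed by times \<open>t \<ge> 0\<close>; conditioning is only on events of positive probability.\<close>

definition markov_with ::
    "'w measure \<Rightarrow> (real \<Rightarrow> 'w \<Rightarrow> 'a) \<Rightarrow> (real \<Rightarrow> 'a \<Rightarrow> 'a pmf) \<Rightarrow> bool" where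
  "markov_with M N P \<longleftrightarrow>
     (\<forall>(t :: nat \<Rightarrow> real) (x :: nat \<Rightarrow> 'a) k j.
        0 \<le> t 0 \<longrightarrow> (\<forall>i\<le>k. t i < t (Suc i)) \<longrightarrow>
        \<P>(\<omega> in M. \<forall>i\<le>k. N (t i) \<omega> = x i) > 0 \<longrightarrow>
        \<P>(\<omega> in M. N (t (Suc k)) \<omega> = j \<bar> \<forall>i\<le>k. N (t i) \<omega> = x i)
          = pmf (P (t (Suc k) - t k) (x k)) j)"

definition birth_death_process ::
    "'w measure \<Rightarrow> (real \<Rightarrow> 'w \<Rightarrow> nat) \<Rightarrow> (nat \<Rightarrow> real) \<Rightarrow> (nat \<Rightarrow> real) \<Rightarrow> bool" where
  "birth_death_process M N birth death \<longleftrightarrow>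
     prob_space M \<and>
     (\<forall>t\<ge>0. N t \<in> M \<rightarrow>\<^sub>M count_space UNIV) \<and>
     (\<exists>P. transition_semigroup P \<and>
          has_transition_rates P (birth_death_rate birth death) \<and>
          markov_with M N P)"

definition laplace_transform :: "(real \<Rightarrow> real) \<Rightarrow> complex \<Rightarrow> complex" where
  "laplace_transform f \<theta> =
     (LINT t:{0..}|lborel. exp (- \<theta> * complex_of_real t) * complex_of_real (f t))"

text \<open>Here \<open>r\<close> is the radius of the circle; only \<open>0 < r < 1\<close> is of interest.\<close>

definition special_F :: "real \<Rightarrow> real \<Rightarrow> complex \<Rightarrow> int \<Rightarrow> complex" where
  "special_F r \<rho> \<theta> n =
     1 / (2 * complex_of_real pi * \<i>) *
     contour_integral (circlepath 0 r)
       (\<lambda>z. exp (complex_of_real \<rho> * z) / (z powi (n + 1) * (1 - z) powr \<theta>))"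

text \<open>A contour from \<open>-\<infinity> - i \<epsilon>\<close> to \<open>-\<infinity> + i \<epsilon>\<close>, parametrised by the whole real line. Since it goes
  from below to above the ray \<open>(-\<infinity>, 1]\<close> without meeting that ray, it automatically passes
  counterclockwise around \<open>1\<close>. The map \<open>\<gamma> \<circ> linepath a b\<close> is the piece of \<open>\<gamma>\<close> between the
  parameters \<open>a\<close> and \<open>b\<close>, reparametrised over \<open>[0, 1]\<close>.\<close>

definition hankel_contour :: "real \<Rightarrow> (real \<Rightarrow> complex) \<Rightarrow> bool" where
  "hankel_contour \<epsilon> \<gamma> \<longleftrightarrow>
     \<epsilon> > 0 \<and>
     (\<forall>a b. a < b \<longrightarrow> valid_path (\<gamma> \<circ> linepath a b)) \<and>
     (\<forall>s. \<not> (Im (\<gamma> s) = 0 \<and> Re (\<gamma> s) \<le> 1)) \<and>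
     filterlim (\<lambda>s. Re (\<gamma> s)) at_bot at_bot \<and>
     ((\<lambda>s. Im (\<gamma> s)) \<longlongrightarrow> - \<epsilon>) at_bot \<and>
     filterlim (\<lambda>s. Re (\<gamma> s)) at_bot at_top \<and>
     ((\<lambda>s. Im (\<gamma> s)) \<longlongrightarrow> \<epsilon>) at_top"

definition improper_contour_integral :: "(real \<Rightarrow> complex) \<Rightarrow> (complex \<Rightarrow> complex) \<Rightarrow> complex" where
  "improper_contour_integral \<gamma> f =
     Lim (at_bot \<times>\<^sub>F at_top) (\<lambda>(a, b). contour_integral (\<gamma> \<circ> linepath a b) f)"

definition special_G :: "(real \<Rightarrow> complex) \<Rightarrow> real \<Rightarrow> complex \<Rightarrow> int \<Rightarrow> complex" where
  "special_G \<gamma> \<rho> \<theta> n =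
     1 / (2 * complex_of_real pi * \<i>) *
     improper_contour_integral \<gamma>
       (\<lambda>z. exp (complex_of_real \<rho> * z) / (z powi (n + 1) * (z - 1) powr \<theta>))"

lemma hankel_contour_example:
  assumes "\<epsilon> > 0"
  shows "hankel_contour \<epsilon> (\<lambda>s. Complex (2 - s\<^sup>2) (2 * \<epsilon> / pi * arctan s))"
  unfolding hankel_contour_def
proof (intro conjI allI impI)
  let ?g = "\<lambda>s::real. Complex (2 - s\<^sup>2) (2 * \<epsilon> / pi * arctan s)"
  show "\<epsilon> > 0" by fact
  show "valid_path (?g \<circ> linepath a b)" if "a < b" for a b :: real
  proof -
    define l where "l = (\<lambda>x::real. (1 - x) * a + x * b)"
    have eq: "?g \<circ> linepath a b =
        (\<lambda>x. complex_of_real (2 - (l x)\<^sup>2) + \<i> * complex_of_real (2 * \<epsilon> / pi * arctan (l x)))"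
      by (auto simp: fun_eq_iff linepath_def l_def complex_eq_iff)
    have l': "(l has_real_derivative (b - a)) (at x)" for x
      unfolding l_def by (auto intro!: derivative_eq_intros)
    have d: "((?g \<circ> linepath a b) has_vector_derivative
        (complex_of_real (- (2 * l x * (b - a))) +
         \<i> * complex_of_real (2 * \<epsilon> / pi * (inverse (1 + (l x)\<^sup>2) * (b - a))))) (at x)" for x
      unfolding eq
      by (rule derivative_eq_intros has_vector_derivative_of_real l' refl DERIV_arctan DERIV_chain2 | simp)+
    have cl: "continuous_on S l" for S
      unfolding l_def by (intro continuous_intros)
    have "1 + (l x)\<^sup>2 \<noteq> 0" for x
      by (metis add_pos_nonneg less_numeral_extra(1,3) zero_le_power2)
    hence "continuous_on {0..1} (\<lambda>x. complex_of_real (- (2 * l x * (b - a))) +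
         \<i> * complex_of_real (2 * \<epsilon> / pi * (inverse (1 + (l x)\<^sup>2) * (b - a))))"
      by (intro continuous_intros cl) auto
    with d have "(?g \<circ> linepath a b) C1_differentiable_on {0..1}"
      unfolding C1_differentiable_on_def by (intro exI conjI ballI)
    thus ?thesis
      unfolding valid_path_def by (rule C1_differentiable_imp_piecewise)
  qed
  show "\<not> (Im (?g s) = 0 \<and> Re (?g s) \<le> 1)" for s
    using assms by auto
  show "filterlim (\<lambda>s. Re (?g s)) at_bot at_bot"
    by simp real_asymp
  show "filterlim (\<lambda>s. Re (?g s)) at_bot at_top"
    by simp real_asymp
  have "((\<lambda>s. 2 * \<epsilon> / pi * arctan s) \<longlongrightarrow> 2 * \<epsilon> / pi * (pi / 2)) at_top"
    by (intro tendsto_intros tendsto_arctan_at_top)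
  thus "((\<lambda>s. Im (?g s)) \<longlongrightarrow> \<epsilon>) at_top" by simp
  have "((\<lambda>s. 2 * \<epsilon> / pi * arctan s) \<longlongrightarrow> 2 * \<epsilon> / pi * (- (pi / 2))) at_bot"
    by (intro tendsto_intros tendsto_arctan_at_bot)
  thus "((\<lambda>s. Im (?g s)) \<longlongrightarrow> - \<epsilon>) at_bot" by simp
qed

definition sqrt_branch :: "nat \<Rightarrow> real \<Rightarrow> (complex \<Rightarrow> complex) \<Rightarrow> bool" where
  "sqrt_branch m \<rho> S \<longleftrightarrow>
     S analytic_on {\<theta>. Re \<theta> > 0} \<and>
     (\<forall>\<theta>. Re \<theta> > 0 \<longrightarrow>
        (S \<theta>)\<^sup>2 = (of_nat m + of_real \<rho> + \<theta>)\<^sup>2 - 4 * of_nat m * of_real \<rho>) \<and>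
     (\<forall>x::real. x > 0 \<longrightarrow> (\<exists>y::real. y > 0 \<and> S (of_real x) = of_real y))"

text \<open>The principal square root works, because the radicand avoids the
  non-positive reals on the right half-plane.\<close>

lemma sqrt_branch_csqrt:
  assumes "m \<ge> 1" "\<rho> > 0"
  shows "sqrt_branch m \<rho>
    (\<lambda>\<theta>. csqrt ((of_nat m + of_real \<rho> + \<theta>)\<^sup>2 - 4 * of_nat m * of_real \<rho>))"
proof -
  let ?D = "\<lambda>\<theta>. (of_nat m + of_real \<rho> + \<theta>)\<^sup>2 - 4 * of_nat m * complex_of_real \<rho>"
  have amgm: "4 * real m * \<rho> \<le> (real m + \<rho>)\<^sup>2"
    using zero_le_power2[of "real m - \<rho>"] by (simp add: power2_eq_square algebra_simps)
  have pos: "(real m + \<rho> + u)\<^sup>2 - 4 * real m * \<rho> > 0" if "u > 0" for u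
  proof -
    have "(real m + \<rho>)\<^sup>2 < (real m + \<rho> + u)\<^sup>2"
      using that assms by (intro power_strict_mono) auto
    with amgm show ?thesis by linarith
  qed
  have nz: "?D \<theta> \<notin> \<real>\<^sub>\<le>\<^sub>0" if "Re \<theta> > 0" for \<theta>
  proof
    assume D: "?D \<theta> \<in> \<real>\<^sub>\<le>\<^sub>0"
    then have "Im (?D \<theta>) = 0" "Re (?D \<theta>) \<le> 0"
      by (auto simp: complex_nonpos_Reals_iff)
    moreover have "real m + \<rho> + Re \<theta> > 0"
      using assms that by linarith
    ultimately have "Im \<theta> = 0" "(real m + \<rho> + Re \<theta>)\<^sup>2 - (Im \<theta>)\<^sup>2 - 4 * real m * \<rho> \<le> 0"
      by (auto simp: power2_eq_square)
    with pos[OF that] show False by simp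
  qed
  show ?thesis
    unfolding sqrt_branch_def
  proof (intro conjI allI impI)
    show "(\<lambda>\<theta>. csqrt (?D \<theta>)) analytic_on {\<theta>. Re \<theta> > 0}"
      using nz by (intro analytic_intros analytic_on_compose[of ?D _ csqrt, unfolded o_def]) auto
    fix x :: real assume "x > 0"
    have "?D (of_real x) = of_real ((real m + \<rho> + x)\<^sup>2 - 4 * real m * \<rho>)" by simp
    hence "csqrt (?D (of_real x)) = of_real (sqrt ((real m + \<rho> + x)\<^sup>2 - 4 * real m * \<rho>))"
      using pos[OF \<open>x > 0\<close>] by (simp only: of_real_sqrt less_imp_le)
    thus "\<exists>y>0. csqrt (?D (of_real x)) = of_real y"
      using pos[OF \<open>x > 0\<close>] real_sqrt_gt_zero by blast
  qed simp
qed

end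

(*
  Conditioning on a short initial time interval gives, for each target state n, the backward
  equations for the Laplace transforms U_i of p_in: a second-order linear recurrence in the starting
  state i with a unit source at i = n. As the rates are bounded and Re theta > 0, a bounded solution
  is unique, so it suffices to exhibit one. It is the Green function pi_n phi_min(i,n) psi_max(i,n),
  where phi is regular at 0, psi is bounded at infinity and pi is the reversible measure: for i <= m
  these are i!/rho^i times F_i and times G_i + kappa F_i, for i >= m powers of the roots A and B.
  The constants reduce to the Casoratian of F and G, hence to G_(-1), which is Hankel's integral for
  1/Gamma(theta). The denominators do not vanish, since otherwise phi would be a bounded
  homogeneous solution.
*)
theory Submission
  imports Defs
begin

section \<open>Laplace transforms of transition probabilities\<close>

text \<open>Backward equations suit the hypotheses: the rates are known only as entrywise
  derivatives at 0, but each row has finitely many nonzero entries and sum 0. So a short first step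
  from i is captured by finitely many states up to an error o(h), whereas the forward equations
  would sum one-step quotients over infinitely many intermediate states. The price is that all
  starting states occur; the semigroup supplies them although the process itself starts in n0. The
  contour of G is prescribed only by its asymptotes and by avoiding the slit. Its integrals are
  therefore not deformed: each integrand has a primitive on the slit plane, and the integral is the
  difference of the limits of that primitive at the two ends. The recurrence and the value of G_(-1)
  both come from this device. That B has modulus at least 1 rests on the analytic branch as a whole,
  not on its value at one \<theta>: the modulus is followed through the half-plane from \<theta> =
  1.\<close>

lemma set_integrable_exp_neg:
  fixes a :: real assumes "a > 0"
  shows "set_integrable lborel {0..} (\<lambda>t. exp (- a * t))"
    and "(LINT t:{0..}|lborel. exp (- a * t)) = 1 / a"
proof -
  have "(\<lambda>t. exp (- a * t)) absolutely_integrable_on {0..}"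
    using assms by (intro nonnegative_absolutely_integrable_1 integrable_on_exp_minus_to_infinity) auto
  then have *: "set_integrable lebesgue {0..} (\<lambda>t. exp (- a * t))" .
  have "(\<lambda>t. indicator {0..} t *\<^sub>R exp (- a * t)) \<in> borel_measurable lborel" by simp
  with * show i: "set_integrable lborel {0..} (\<lambda>t. exp (- a * t))"
    unfolding set_integrable_def by (subst (asm) integrable_completion) auto
  have "((\<lambda>t. exp (- a * t)) has_integral exp (- a * 0) / a) {0..}"
    by (rule has_integral_exp_minus_to_infinity) (use assms in auto)
  then show "(LINT t:{0..}|lborel. exp (- a * t)) = 1 / a"
    using set_borel_integral_eq_integral(2)[OF i] by (simp add: integral_unique)
qed

lemma laplace_set_integrable:
  fixes g :: "real \<Rightarrow> real"
  assumes "Re \<theta> > 0" and meas: "set_borel_measurable borel {0..} g"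
    and bound: "\<And>t. t \<ge> 0 \<Longrightarrow> \<bar>g t\<bar> \<le> C"
  shows "set_integrable lborel {0..} (\<lambda>t. exp (- \<theta> * complex_of_real t) * complex_of_real (g t))"
    and "norm (laplace_transform g \<theta>) \<le> C / Re \<theta>"
proof -
  let ?f = "\<lambda>t. exp (- \<theta> * complex_of_real t) * complex_of_real (g t)"
  have m: "(\<lambda>t. exp (- \<theta> * complex_of_real t) * complex_of_real (indicator {0..} t *\<^sub>R g t)) \<in> borel_measurable borel"
  proof -
    have [measurable]: "(\<lambda>t. indicator {0..} t *\<^sub>R g t) \<in> borel_measurable borel"
      using meas by (simp add: set_borel_measurable_def)
    have [measurable]: "(\<lambda>t. exp (- \<theta> * complex_of_real t)) \<in> borel_measurable borel"
      by (intro borel_measurable_continuous_onI continuous_intros)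
    show ?thesis by measurable
  qed
  have eq: "(\<lambda>t. exp (- \<theta> * complex_of_real t) * complex_of_real (indicator {0..} t *\<^sub>R g t))
      = (\<lambda>t. indicator {0..} t *\<^sub>R ?f t)"
    by (auto simp: indicator_def)
  have C: "C \<ge> 0" using bound[of 0] by linarith
  have b: "norm (?f t) \<le> C * exp (- Re \<theta> * t)" if "t \<ge> 0" for t
    using bound[OF that] by (simp add: norm_mult mult.commute mult_right_mono)
  have ie: "set_integrable lborel {0..} (\<lambda>t. C * exp (- Re \<theta> * t))"
    using set_integrable_exp_neg(1)[OF assms(1)] by simp
  show i: "set_integrable lborel {0..} ?f"
    unfolding set_integrable_def
  proof (rule Bochner_Integration.integrable_bound[OF ie[unfolded set_integrable_def]])
    show "(\<lambda>t. indicator {0..} t *\<^sub>R ?f t) \<in> borel_measurable lborel" using m eq by simp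
    show "AE t in lborel. norm (indicator {0..} t *\<^sub>R ?f t) \<le> norm (indicator {0..} t *\<^sub>R (C * exp (- Re \<theta> * t)))"
      using b C by (intro AE_I2) (auto simp: indicator_def norm_mult)
  qed
  have "norm (laplace_transform g \<theta>) \<le> (LINT t:{0..}|lborel. norm (?f t))"
    unfolding laplace_transform_def by (rule set_integral_norm_bound[OF i])
  also have "\<dots> \<le> (LINT t:{0..}|lborel. C * exp (- Re \<theta> * t))"
    using b by (intro set_integral_mono set_integrable_norm i ie) auto
  also have "\<dots> = C / Re \<theta>"
    using set_integrable_exp_neg(2)[OF assms(1)] by simp
  finally show "norm (laplace_transform g \<theta>) \<le> C / Re \<theta>" .
qed

lemma set_integral_finite_sum:
  fixes f :: "'b \<Rightarrow> 'a \<Rightarrow> complex"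
  assumes "\<And>k. k \<in> K \<Longrightarrow> set_integrable M A (f k)"
  shows "set_integrable M A (\<lambda>x. \<Sum>k\<in>K. f k x)"
    and "(LINT x:A|M. (\<Sum>k\<in>K. f k x)) = (\<Sum>k\<in>K. LINT x:A|M. f k x)"
  using assms unfolding set_integrable_def set_lebesgue_integral_def scaleR_sum_right
  by (simp_all add: Bochner_Integration.integrable_sum Bochner_Integration.integral_sum del: of_bool_eq)

section \<open>Truncated Chapman-Kolmogorov equations and the backward equations\<close>

text \<open>The Chapman-Kolmogorov integral is split at a finite set K: the part outside K is
  nonnegative and at most the mass sitting there, because the integrand is at most 1.\<close>

lemma semigroup_expand:
  assumes "transition_semigroup P" "s \<ge> 0" "t \<ge> 0" "finite K"
  shows "(\<Sum>k\<in>K. pmf (P s i) k * pmf (P t k) j) \<le> pmf (P (s + t) i) j"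
    and "pmf (P (s + t) i) j \<le> (\<Sum>k\<in>K. pmf (P s i) k * pmf (P t k) j) + (1 - (\<Sum>k\<in>K. pmf (P s i) k))"
proof -
  let ?m = "measure_pmf (P s i)"
  have eq: "pmf (P (s + t) i) j = (\<integral>k. pmf (P t k) j \<partial>?m)"
    using assms by (simp add: transition_semigroup_def pmf_bind)
  have int: "integrable ?m (\<lambda>k. indicator B k * pmf (P t k) j)" for B
    by (rule measure_pmf.integrable_const_bound[where B = 1]) (auto simp: indicator_def pmf_le_1)
  have split: "(\<integral>k. pmf (P t k) j \<partial>?m) =
      (\<integral>k. indicator K k * pmf (P t k) j \<partial>?m) + (\<integral>k. indicator (-K) k * pmf (P t k) j \<partial>?m)"
    by (subst Bochner_Integration.integral_add[symmetric, OF int int])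
       (auto intro!: Bochner_Integration.integral_cong simp: indicator_def)
  have K: "(\<integral>k. indicator K k * pmf (P t k) j \<partial>?m) = (\<Sum>k\<in>K. pmf (P s i) k * pmf (P t k) j)"
    by (subst integral_measure_pmf[OF \<open>finite K\<close>]) (auto simp: indicator_def)
  have "(\<integral>k. indicator (-K) k * pmf (P t k) j \<partial>?m) \<le> (\<integral>k. indicator (-K) k \<partial>?m)"
    by (intro integral_mono int measure_pmf.integrable_const_bound[where B = 1])
       (auto simp: indicator_def pmf_le_1)
  also have "\<dots> = 1 - (\<Sum>k\<in>K. pmf (P s i) k)"
    using assms(4) by (simp add: measure_pmf.prob_compl[of K, simplified, unfolded Compl_eq_Diff_UNIV[symmetric]] measure_measure_pmf_finite)
  finally show "pmf (P (s + t) i) j \<le> (\<Sum>k\<in>K. pmf (P s i) k * pmf (P t k) j) + (1 - (\<Sum>k\<in>K. pmf (P s i) k))"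
    unfolding eq split K by simp
  have "0 \<le> (\<integral>k. indicator (-K) k * pmf (P t k) j \<partial>?m)"
    by (intro Bochner_Integration.integral_nonneg) auto
  then show "(\<Sum>k\<in>K. pmf (P s i) k * pmf (P t k) j) \<le> pmf (P (s + t) i) j"
    unfolding eq split K by simp
qed

lemma transition_at_0:
  assumes "transition_semigroup P" "has_transition_rates P q"
  shows "((\<lambda>h. pmf (P h i) i) \<longlongrightarrow> 1) (at_right 0)"
proof -
  have "((\<lambda>h. (pmf (P h i) i - pmf (P 0 i) i) / h) \<longlongrightarrow> q i i) (at_right 0)"
    using assms by (simp add: has_transition_rates_def)
  from tendsto_add[OF tendsto_mult[OF this tendsto_ident_at] tendsto_const[of 1]]
  have "((\<lambda>h. (pmf (P h i) i - pmf (P 0 i) i) / h * h + 1) \<longlongrightarrow> 1) (at_right 0)" by simp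
  moreover have "\<forall>\<^sub>F h in at_right 0. (pmf (P h i) i - pmf (P 0 i) i) / h * h + 1 = pmf (P h i) i"
    using assms(1) by (auto simp: eventually_at_filter transition_semigroup_def)
  ultimately show ?thesis by (rule Lim_transform_eventually)
qed

text \<open>With K = {i} the truncated expansion bounds the increment over a time h by the
  probability of not being in i at time h. This bound does not depend on t, so the limit at time 0
  gives continuity everywhere.\<close>

lemma transition_continuous:
  assumes sg: "transition_semigroup P" and r: "has_transition_rates P q"
  shows "continuous_on {0..} (\<lambda>t. pmf (P t i) j)"
  unfolding continuous_on_iff
proof (intro ballI allI impI)
  have diff: "\<bar>pmf (P (h + t) i) j - pmf (P t i) j\<bar> \<le> 1 - pmf (P h i) i" if "h \<ge> 0" "t \<ge> 0" for h t
  proof -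
    have "pmf (P h i) i * pmf (P t i) j \<le> pmf (P (h+t) i) j"
      "pmf (P (h+t) i) j \<le> pmf (P h i) i * pmf (P t i) j + (1 - pmf (P h i) i)"
      using semigroup_expand[OF sg that, of "{i}" i j] by auto
    moreover have "pmf (P h i) i * pmf (P t i) j \<le> pmf (P t i) j"
      using mult_right_mono[OF pmf_le_1 pmf_nonneg, of "P h i" i "P t i" j] by simp
    moreover have "pmf (P t i) j * (1 - pmf (P h i) i) \<le> 1 * (1 - pmf (P h i) i)"
      by (intro mult_right_mono) (auto simp: pmf_le_1)
    ultimately show ?thesis by (auto simp: abs_le_iff algebra_simps)
  qed
  fix t e :: real assume t: "t \<in> {0..}" and e: "e > 0"
  have "\<forall>\<^sub>F h in at_right 0. 1 - pmf (P h i) i < e"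
    using order_tendstoD(1)[OF transition_at_0[OF sg r, of i], of "1 - e"] e by (simp add: algebra_simps)
  then obtain d where d: "d > 0" "\<And>h. h > 0 \<Longrightarrow> h < d \<Longrightarrow> 1 - pmf (P h i) i < e"
    by (auto simp: eventually_at_right_field)
  show "\<exists>d>0. \<forall>x\<in>{0..}. dist x t < d \<longrightarrow> dist (pmf (P x i) j) (pmf (P t i) j) < e"
  proof (intro exI conjI ballI impI)
    fix x assume x: "x \<in> {0..}" "dist x t < d"
    consider "x = t" | "x < t" | "t < x" by linarith
    then show "dist (pmf (P x i) j) (pmf (P t i) j) < e"
    proof cases
      case 2
      then show ?thesis using diff[of "t - x" x] d(2)[of "t - x"] x t by (auto simp: dist_real_def)
    next
      case 3
      then show ?thesis using diff[of "x - t" t] d(2)[of "x - t"] x t by (auto simp: dist_real_def)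
    qed (use e in auto)
  qed (fact d)
qed

text \<open>Comparing the Laplace transform of a small time shift with the Chapman-Kolmogorov expansion
  avoids differentiating the transition probabilities.\<close>

lemma laplace_backward:
  fixes i j :: 'a
  assumes sg: "transition_semigroup P" and r: "has_transition_rates P q"
    and K: "finite K" "i \<in> K" "(\<Sum>k\<in>K. q i k) = 0" and th: "Re \<theta> > 0"
  defines "R \<equiv> \<lambda>k. laplace_transform (\<lambda>t. pmf (P t k) j) \<theta>"
  shows "\<theta> * R i = (if i = j then 1 else 0) + (\<Sum>k\<in>K. of_real (q i k) * R k)"
proof -
  define f where "f = (\<lambda>k t. exp (- \<theta> * complex_of_real t) * complex_of_real (pmf (P t k) j))"
  have meas: "set_borel_measurable borel {0..} (\<lambda>t. pmf (P t k) j)" for k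
    unfolding set_borel_measurable_def
    using borel_measurable_continuous_on_indicator[OF _ transition_continuous[OF sg r, of k j]] by simp
  have int: "set_integrable lborel {0..} (f k)" for k
    unfolding f_def by (rule laplace_set_integrable[OF th meas, where C = 1]) (auto simp: pmf_le_1)
  have cont: "continuous_on {0..} (f k)" for k
    unfolding f_def by (intro continuous_intros transition_continuous[OF sg r])
  have R: "R k = (LINT t:{0..}|lborel. f k t)" for k
    by (simp add: R_def laplace_transform_def f_def)
  define I where "I = (\<lambda>h. integral {0..h} (f i))"
  \<comment> \<open>The contribution of intermediate states outside K. Its transform turns out to be
    o(h).\<close>
  define err where "err = (\<lambda>h t. pmf (P (h + t) i) j - (\<Sum>k\<in>K. pmf (P h i) k * pmf (P t k) j))"
  define e where "e = (\<lambda>h. laplace_transform (err h) \<theta>)"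
  have key: "exp (\<theta> * of_real h) * (R i - I h) = (\<Sum>k\<in>K. of_real (pmf (P h i) k) * R k) + e h"
    and e_bound: "norm (e h) \<le> (1 - (\<Sum>k\<in>K. pmf (P h i) k)) / Re \<theta>" if h: "h > 0" for h
  proof -
    have "continuous_on {0..} (err h)"
      unfolding err_def using h
      by (intro continuous_intros transition_continuous[OF sg r]
           continuous_on_compose2[OF transition_continuous[OF sg r, of i j], where f = "\<lambda>t. h + t"]) auto
    then have em: "set_borel_measurable borel {0..} (err h)"
      unfolding set_borel_measurable_def by (intro borel_measurable_continuous_on_indicator) auto
    have eb: "\<bar>err h t\<bar> \<le> 1 - (\<Sum>k\<in>K. pmf (P h i) k)" if "t \<ge> 0" for t
      using semigroup_expand[OF sg less_imp_le[OF h] that K(1), of i j] by (auto simp: err_def abs_le_iff)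
    show "norm (e h) \<le> (1 - (\<Sum>k\<in>K. pmf (P h i) k)) / Re \<theta>"
      unfolding e_def by (rule laplace_set_integrable(2)[OF th em eb])
    have ei: "set_integrable lborel {0..} (\<lambda>t. exp (- \<theta> * complex_of_real t) * complex_of_real (err h t))"
      by (rule laplace_set_integrable(1)[OF th em eb])
    \<comment> \<open>The factor exp(\<theta> h) undoes the shift inside the exponential, so the
      integrand is that of the transform of p(h + t), and the expansion over K applies under the
      integral.\<close>
    have "(LINT t:{0..}|lborel. exp (\<theta> * of_real h) * f i (h + t))
       = (LINT t:{0..}|lborel. (\<Sum>k\<in>K. of_real (pmf (P h i) k) * f k t) +
            exp (- \<theta> * complex_of_real t) * complex_of_real (err h t))"
      by (intro set_lebesgue_integral_cong)
         (auto simp: f_def err_def algebra_simps sum_distrib_left simp flip: exp_add)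
    also have "\<dots> = (LINT t:{0..}|lborel. (\<Sum>k\<in>K. of_real (pmf (P h i) k) * f k t)) + e h"
      unfolding e_def laplace_transform_def
      by (intro set_integral_add ei set_integral_finite_sum(1) set_integrable_mult_right int)
    also have "(LINT t:{0..}|lborel. (\<Sum>k\<in>K. of_real (pmf (P h i) k) * f k t)) = (\<Sum>k\<in>K. of_real (pmf (P h i) k) * R k)"
      unfolding R by (subst set_integral_finite_sum(2)) (auto intro!: set_integrable_mult_right int)
    finally have 1: "exp (\<theta> * of_real h) * (LINT t:{0..}|lborel. f i (h + t)) = (\<Sum>k\<in>K. of_real (pmf (P h i) k) * R k) + e h"
      by simp
    have "(LINT t:{0..}|lborel. f i (h + t)) = (LINT t:{h..}|lborel. f i t)"
      unfolding set_lebesgue_integral_def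
      by (subst (2) lborel_integral_real_affine[where c = 1 and t = h])
         (auto intro!: Bochner_Integration.integral_cong simp: indicator_def)
    also have "\<dots> = R i - I h"
    proof -
      have sub: "set_integrable lborel {h..} (f i)" "set_integrable lborel {0..h} (f i)"
        by (rule set_integrable_subset[OF int]; use h in auto)+
      have "(LINT t:{0..}|lborel. f i t) = (LINT t:{0..h} \<union> {h..}|lborel. f i t)"
        using h by (intro arg_cong[where f = "\<lambda>S. complex_set_lebesgue_integral lborel S (f i)"]) auto
      also have "\<dots> = (LINT t:{0..h}|lborel. f i t) + (LINT t:{h..}|lborel. f i t)"
      proof (rule set_integral_Un_AE[OF _ _ _ sub(2,1)])
        show "AE x in lborel. \<not> (x \<in> {0..h} \<and> x \<in> {h..})"
          using AE_lborel_singleton[of h] by eventually_elim auto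
      qed auto
      also have "(LINT t:{0..h}|lborel. f i t) = I h"
        unfolding I_def by (rule set_borel_integral_eq_integral(2)[OF sub(2)])
      finally show ?thesis using R by simp
    qed
    finally show "exp (\<theta> * of_real h) * (R i - I h) = (\<Sum>k\<in>K. of_real (pmf (P h i) k) * R k) + e h"
      using 1 by simp
  qed
  have P0: "pmf (P 0 k) l = (if k = l then 1 else 0)" for k l
    using sg by (auto simp: transition_semigroup_def indicator_def)
  have rate: "((\<lambda>h. (pmf (P h k) l - (if k = l then 1 else 0)) / h) \<longlongrightarrow> q k l) (at_right 0)" for k l
    using r P0 by (simp add: has_transition_rates_def)
  have Klim: "((\<lambda>h. \<Sum>k\<in>K. (pmf (P h i) k - (if i = k then 1 else 0)) / h) \<longlongrightarrow> 0) (at_right 0)"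
    using tendsto_sum[of K "\<lambda>k h. (pmf (P h i) k - (if i = k then 1 else 0)) / h", OF rate[of i]] K(3)
    by simp
  have sum1: "(\<Sum>k\<in>K. (if i = k then 1 else 0)) = (1::real)"
    using K by simp
  \<comment> \<open>The mass outside K divided by h is minus the sum over K of the difference
    quotients, which tends to minus the sum of the rates in K, that is, to 0.\<close>
  have elim0: "((\<lambda>h. e h / of_real h) \<longlongrightarrow> 0) (at_right 0)"
  proof (rule Lim_null_comparison)
    show "\<forall>\<^sub>F h in at_right 0. norm (e h / of_real h) \<le>
        - (\<Sum>k\<in>K. (pmf (P h i) k - (if i = k then 1 else 0)) / h) / Re \<theta>"
    proof (unfold eventually_at_filter, rule always_eventually, intro allI impI)
      fix h :: real assume "h \<noteq> 0" "h \<in> {0<..}"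
      then have h: "h > 0" by simp
      have "- (\<Sum>k\<in>K. (pmf (P h i) k - (if i = k then 1 else 0)) / h) / Re \<theta>
          = ((1 - (\<Sum>k\<in>K. pmf (P h i) k)) / Re \<theta>) / h"
        using h th by (simp only: sum_divide_distrib[symmetric] sum_subtractf sum1) (simp add: field_simps)
      then show "norm (e h / of_real h) \<le> - (\<Sum>k\<in>K. (pmf (P h i) k - (if i = k then 1 else 0)) / h) / Re \<theta>"
        using divide_right_mono[OF e_bound[OF h], of h] h by (simp only: norm_divide) simp
    qed
    show "((\<lambda>h. - (\<Sum>k\<in>K. (pmf (P h i) k - (if i = k then 1 else 0)) / h) / Re \<theta>) \<longlongrightarrow> 0) (at_right 0)"
      using tendsto_divide[OF tendsto_minus[OF Klim] tendsto_const[of "Re \<theta>"]] th by simp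
  qed
  \<comment> \<open>The source of the equation: I is differentiable at 0 from the right with
    derivative \<open>f i 0\<close>, the Kronecker delta of i and j.\<close>
  have Ilim: "((\<lambda>h. I h / of_real h) \<longlongrightarrow> (if i = j then 1 else 0)) (at_right 0)"
  proof -
    have "(I has_vector_derivative f i 0) (at 0 within {0..1})"
      unfolding I_def by (rule integral_has_vector_derivative) (auto intro: continuous_on_subset[OF cont])
    then have "(I has_vector_derivative f i 0) (at_right 0)"
      by (simp add: has_vector_derivative_def at_within_Icc_at_right)
    then have "((\<lambda>h. (1 / norm h) *\<^sub>R (I h - (I 0 + h *\<^sub>R f i 0))) \<longlongrightarrow> 0) (at_right 0)"
      by (simp add: has_vector_derivative_def has_derivative_within)
    moreover have "\<forall>\<^sub>F h in at_right 0. (1 / norm h) *\<^sub>R (I h - (I 0 + h *\<^sub>R f i 0)) = I h / of_real h - f i 0"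
      unfolding eventually_at_filter
      by (intro always_eventually) (auto simp: I_def scaleR_conv_of_real field_simps)
    ultimately have "((\<lambda>h. I h / of_real h - f i 0) \<longlongrightarrow> 0) (at_right 0)"
      by (rule Lim_transform_eventually)
    then show ?thesis by (auto dest!: LIM_zero_cancel simp: f_def P0)
  qed
  have exlim: "((\<lambda>h. (exp (\<theta> * of_real h) - 1) / of_real h) \<longlongrightarrow> \<theta>) (at_right (0::real))"
  proof -
    have "((\<lambda>z. exp (\<theta> * z)) has_field_derivative \<theta>) (at 0)"
      by (auto intro!: derivative_eq_intros)
    then have "((\<lambda>z. (exp (\<theta> * z) - 1) / z) \<longlongrightarrow> \<theta>) (at 0)"
      by (simp add: has_field_derivative_iff)
    moreover have "filterlim (\<lambda>h::real. complex_of_real h) (at 0) (at_right 0)"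
      unfolding filterlim_at by (auto simp: eventually_at_filter intro!: tendsto_eq_intros)
    ultimately show ?thesis by (rule filterlim_compose)
  qed
  have exp1: "((\<lambda>h. exp (\<theta> * of_real h)) \<longlongrightarrow> 1) (at_right (0::real))"
    by (auto intro!: tendsto_eq_intros)
  \<comment> \<open>This is the left side of \<open>key\<close> divided by h, arranged so that every
    term has a limit; the sum that follows is the right side.\<close>
  have L: "((\<lambda>h. (exp (\<theta> * of_real h) - 1) / of_real h * R i - exp (\<theta> * of_real h) * (I h / of_real h))
       \<longlongrightarrow> \<theta> * R i - 1 * (if i = j then 1 else 0)) (at_right 0)"
    by (intro tendsto_intros exlim exp1 Ilim)
  have "((\<lambda>h. (\<Sum>k\<in>K. of_real ((pmf (P h i) k - (if i = k then 1 else 0)) / h) * R k) + e h / of_real h)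
       \<longlongrightarrow> (\<Sum>k\<in>K. of_real (q i k) * R k) + 0) (at_right 0)"
    by (intro tendsto_intros rate elim0)
  moreover have ev: "\<forall>\<^sub>F h in at_right 0. (exp (\<theta> * of_real h) - 1) / of_real h * R i - exp (\<theta> * of_real h) * (I h / of_real h)
     = (\<Sum>k\<in>K. of_real ((pmf (P h i) k - (if i = k then 1 else 0)) / h) * R k) + e h / of_real h"
  proof (unfold eventually_at_filter, rule always_eventually, intro allI impI)
    fix h :: real assume "h \<noteq> 0" "h \<in> {0<..}"
    then have h: "h > 0" by simp
    have "(\<Sum>k\<in>K. (if i = k then 1 else 0) * R k) = R i"
      using K by (simp add: if_distrib[of "\<lambda>x. x * _"] cong: if_cong)
    moreover have "(\<Sum>k\<in>K. of_real ((pmf (P h i) k - (if i = k then 1 else 0)) / h) * R k)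
       = (\<Sum>k\<in>K. (of_real (pmf (P h i) k) * R k - (if i = k then 1 else 0) * R k) / of_real h)"
      by (intro sum.cong) (auto simp: diff_divide_distrib algebra_simps)
    ultimately have "(\<Sum>k\<in>K. of_real ((pmf (P h i) k - (if i = k then 1 else 0)) / h) * R k)
       = ((\<Sum>k\<in>K. of_real (pmf (P h i) k) * R k) - R i) / of_real h"
      by (simp only: sum_divide_distrib[symmetric] sum_subtractf)
    also have "\<dots> = (exp (\<theta> * of_real h) * (R i - I h) - e h - R i) / of_real h"
      using key[OF h] by simp
    finally have X: "(\<Sum>k\<in>K. of_real ((pmf (P h i) k - (if i = k then 1 else 0)) / h) * R k)
       = (exp (\<theta> * of_real h) * (R i - I h) - e h - R i) / of_real h" .
    show "(exp (\<theta> * of_real h) - 1) / of_real h * R i - exp (\<theta> * of_real h) * (I h / of_real h)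
     = (\<Sum>k\<in>K. of_real ((pmf (P h i) k - (if i = k then 1 else 0)) / h) * R k) + e h / of_real h"
      unfolding X using h by (simp add: diff_divide_distrib left_diff_distrib right_diff_distrib)
  qed
  ultimately have "\<theta> * R i - 1 * (if i = j then 1 else 0) = (\<Sum>k\<in>K. of_real (q i k) * R k) + 0"
    using tendsto_unique[OF trivial_limit_at_right_real L] by (simp only: tendsto_cong[OF ev])
  then show ?thesis by (simp add: algebra_simps)
qed

section \<open>Integrals over Hankel contours\<close>

text \<open>An end of a Hankel contour is given only by real parts tending to minus infinity and
  imaginary parts tending to y. Limits of primitives are taken along exactly this filter, so they
  apply to every admissible contour.\<close>

definition strip_end :: "real \<Rightarrow> complex filter" where
  "strip_end y = inf (filtercomap Re at_bot) (filtercomap Im (nhds y))"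

lemma filterlim_strip_end_iff:
  "filterlim g (strip_end y) F \<longleftrightarrow> filterlim (\<lambda>x. Re (g x)) at_bot F \<and> ((\<lambda>x. Im (g x)) \<longlongrightarrow> y) F"
  by (simp add: strip_end_def filterlim_inf filterlim_filtercomap_iff o_def)

lemma strip_end_Re: "filterlim Re at_bot (strip_end y)"
  and strip_end_Im: "(Im \<longlongrightarrow> y) (strip_end y)"
  using filterlim_strip_end_iff[of "\<lambda>z. z" y "strip_end y"] by (simp_all add: filterlim_ident)

lemma eventually_strip_end_Re: "\<forall>\<^sub>F z in strip_end y. Re z < x"
  using strip_end_Re by (simp add: filterlim_at_bot_dense)

lemma exp_Re_strip_end:
  assumes "a > 0" shows "((\<lambda>z. exp (a * Re z)) \<longlongrightarrow> 0) (strip_end y)"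
  by (rule filterlim_compose[OF exp_at_bot filterlim_tendsto_pos_mult_at_bot[OF tendsto_const assms strip_end_Re]])

lemma strip_end_neq_bot: "strip_end y \<noteq> bot"
proof -
  have "filterlim (\<lambda>t. Complex t y) (strip_end y) at_bot"
    by (simp add: filterlim_strip_end_iff filterlim_ident)
  then have "filtermap (\<lambda>t. Complex t y) at_bot \<le> strip_end y"
    by (simp add: filterlim_def)
  moreover have "filtermap (\<lambda>t. Complex t y) at_bot \<noteq> bot"
    by (simp add: filtermap_bot_iff)
  ultimately show ?thesis using le_bot by metis
qed

text \<open>An exponentially small derivative makes \<Phi> Cauchy along the filter. Two points of
  the strip are joined by a horizontal segment, compared with the primitive (C/a) exp(a t), and by a
  vertical one of length at most 2 d taken at the larger real part.\<close>

lemma strip_convergent: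
  assumes deriv: "\<And>z. Re z < X \<Longrightarrow> \<bar>Im z - y\<bar> < d \<Longrightarrow> (\<Phi> has_field_derivative f z) (at z)"
    and bound: "\<And>z. Re z < X \<Longrightarrow> \<bar>Im z - y\<bar> < d \<Longrightarrow> norm (f z) \<le> C * exp (a * Re z)"
    and "a > 0" "d > 0"
  shows "\<exists>L. (\<Phi> \<longlongrightarrow> L) (strip_end y)"
proof -
  have C: "C \<ge> 0"
    using order_trans[OF norm_ge_zero bound[of "Complex (X - 1) y"]] \<open>d > 0\<close> by (auto simp: zero_le_mult_iff)
  have est: "dist (\<Phi> z) (\<Phi> w) \<le> C * (2 * d + 1 / a) * exp (a * Re w)"
    if z: "Re z \<le> Re w" "\<bar>Im z - y\<bar> < d" and w: "Re w < X" "\<bar>Im w - y\<bar> < d" for z w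
  proof -
    define v where "v = Complex (Re w) (Im z)"
    have "norm (\<Phi> w - \<Phi> v) \<le> (C * exp (a * Re w)) * norm (w - v)"
    proof (rule field_differentiable_bound[where f' = f])
      have in_strip: "Re u = Re w \<and> \<bar>Im u - y\<bar> < d" if "u \<in> closed_segment v w" for u
      proof -
        have "closed_segment v w \<subseteq> {u. Re u = Re w} \<inter> {u. Im u > y - d} \<inter> {u. Im u < y + d}"
          using z w convex_hyperplane[of "1::complex" "Re w"]
          by (intro closed_segment_subset convex_Int convex_halfspace_Im_gt convex_halfspace_Im_lt)
             (auto simp: v_def abs_less_iff)
        with that show ?thesis by (auto dest!: subsetD[where c = u])
      qed
      show "(\<Phi> has_field_derivative f u) (at u within closed_segment v w)" if "u \<in> closed_segment v w" for u
        using in_strip[OF that] w(1) by (auto intro: has_field_derivative_at_within[OF deriv])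
      show "norm (f u) \<le> C * exp (a * Re w)" if "u \<in> closed_segment v w" for u
        using in_strip[OF that] w(1) bound[of u] by auto
    qed auto
    also have "\<dots> \<le> (C * exp (a * Re w)) * (2 * d)"
    proof -
      have "norm (w - v) \<le> 2 * d"
        using z w cmod_le[of "w - v"] by (auto simp: v_def)
      then show ?thesis using C by (intro mult_left_mono) auto
    qed
    finally have 1: "norm (\<Phi> w - \<Phi> v) \<le> (C * exp (a * Re w)) * (2 * d)" .
    have 2: "norm (\<Phi> v - \<Phi> z) \<le> C / a * exp (a * Re w)"
    proof (cases "Re z = Re w")
      case True
      then have "v = z" by (simp add: v_def complex_eq_iff)
      then show ?thesis using C \<open>a > 0\<close> by simp
    next
      case False
      have d1: "((\<lambda>t. \<Phi> (Complex t (Im z))) has_vector_derivative f (Complex t (Im z))) (at t)" if "t \<le> Re w" for t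
      proof -
        have "((\<lambda>t. Complex t (Im z)) has_vector_derivative 1) (at t)"
          by (simp add: has_vector_derivative_complex_iff)
        from field_vector_diff_chain_at[OF this deriv] show ?thesis
          using that w z by (simp add: o_def)
      qed
      have "norm (\<Phi> (Complex (Re w) (Im z)) - \<Phi> (Complex (Re z) (Im z))) \<le> C / a * exp (a * Re w) - C / a * exp (a * Re z)"
      proof (rule differentiable_bound_general[where f' = "\<lambda>t. f (Complex t (Im z))" and \<phi>' = "\<lambda>t. C * exp (a * t)"])
        show "Re z < Re w" using False z by simp
        show "continuous_on {Re z..Re w} (\<lambda>t. \<Phi> (Complex t (Im z)))"
          by (auto intro!: continuous_at_imp_continuous_on has_vector_derivative_continuous[OF d1])
        show "continuous_on {Re z..Re w} (\<lambda>t. C / a * exp (a * t))" by (intro continuous_intros)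
        show "((\<lambda>t. C / a * exp (a * t)) has_vector_derivative C * exp (a * t)) (at t)" for t
          unfolding has_real_derivative_iff_has_vector_derivative[symmetric]
          using \<open>a > 0\<close> by (auto intro!: derivative_eq_intros)
        show "norm (f (Complex t (Im z))) \<le> C * exp (a * t)" if "t < Re w" for t
          using that bound[of "Complex t (Im z)"] w z by auto
      qed (use d1 in auto)
      moreover have "C / a * exp (a * Re z) \<ge> 0" using C \<open>a > 0\<close> by simp
      ultimately show ?thesis by (simp add: v_def)
    qed
    have "dist (\<Phi> z) (\<Phi> w) \<le> norm (\<Phi> w - \<Phi> v) + norm (\<Phi> v - \<Phi> z)"
      by (metis dist_commute dist_norm dist_triangle)
    also have "\<dots> \<le> C * (2 * d + 1 / a) * exp (a * Re w)"
      using 1 2 by (simp add: algebra_simps)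
    finally show ?thesis .
  qed
  have "cauchy_filter (filtermap \<Phi> (strip_end y))"
    unfolding cauchy_filter_metric_filtermap
  proof (intro allI impI)
    fix e :: real assume e: "e > 0"
    let ?K = "C * (2 * d + 1 / a)"
    have "((\<lambda>z. ?K * exp (a * Re z)) \<longlongrightarrow> ?K * 0) (strip_end y)"
      by (intro tendsto_intros exp_Re_strip_end \<open>a > 0\<close>)
    then have ev: "\<forall>\<^sub>F z in strip_end y. ?K * exp (a * Re z) < e"
      using e by (intro order_tendstoD(2)) auto
    have ev2: "\<forall>\<^sub>F z in strip_end y. \<bar>Im z - y\<bar> < d"
      using tendstoD[OF strip_end_Im \<open>d > 0\<close>] by (simp add: dist_real_def)
    let ?P = "\<lambda>z. ?K * exp (a * Re z) < e \<and> \<bar>Im z - y\<bar> < d \<and> Re z < X"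
    show "\<exists>P. eventually P (strip_end y) \<and> (\<forall>z w. P z \<and> P w \<longrightarrow> dist (\<Phi> z) (\<Phi> w) < e)"
    proof (intro exI[of _ ?P] conjI allI impI)
      show "eventually ?P (strip_end y)"
        by (intro eventually_conj ev ev2 eventually_strip_end_Re)
      fix z w assume "?P z \<and> ?P w"
      then show "dist (\<Phi> z) (\<Phi> w) < e"
        using est[of z w] est[of w z] by (cases "Re z \<le> Re w") (auto simp: dist_commute)
    qed
  qed
  moreover have "filtermap \<Phi> (strip_end y) \<noteq> bot"
    using strip_end_neq_bot by (simp add: filtermap_bot_iff)
  ultimately obtain L where "filtermap \<Phi> (strip_end y) \<le> nhds L"
    using cauchy_filter_complete_converges[of "filtermap \<Phi> (strip_end y)" UNIV] by (auto simp: complete_UNIV)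
  then show ?thesis by (auto simp: filterlim_def)
qed

text \<open>Every finite piece of \<gamma> stays off the slit, so its integral depends on its
  endpoints alone; in the limit only the heights of the two asymptotes matter.\<close>

lemma improper_contour_integral_primitive:
  assumes \<gamma>: "hankel_contour \<epsilon> \<gamma>"
    and deriv: "\<And>z. z - 1 \<notin> \<real>\<^sub>\<le>\<^sub>0 \<Longrightarrow> (\<Phi> has_field_derivative f z) (at z)"
    and lim: "(\<Phi> \<longlongrightarrow> Lp) (strip_end \<epsilon>)" "(\<Phi> \<longlongrightarrow> Lm) (strip_end (- \<epsilon>))"
  shows "improper_contour_integral \<gamma> f = Lp - Lm"
  unfolding improper_contour_integral_def
proof (rule tendsto_Lim)
  show "at_bot \<times>\<^sub>F at_top \<noteq> (bot :: (real \<times> real) filter)"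
    by (simp add: prod_filter_eq_bot)
  have off_cut: "\<gamma> s - 1 \<notin> \<real>\<^sub>\<le>\<^sub>0" for s
    using \<gamma> by (auto simp: hankel_contour_def complex_nonpos_Reals_iff)
  have int: "contour_integral (\<gamma> \<circ> linepath a b) f = \<Phi> (\<gamma> b) - \<Phi> (\<gamma> a)" if "a < b" for a b
  proof -
    have "(f has_contour_integral (\<Phi> (pathfinish (\<gamma> \<circ> linepath a b)) - \<Phi> (pathstart (\<gamma> \<circ> linepath a b))))
        (\<gamma> \<circ> linepath a b)"
    proof (rule contour_integral_primitive[where S = "{z. z - 1 \<notin> \<real>\<^sub>\<le>\<^sub>0}"])
      show "valid_path (\<gamma> \<circ> linepath a b)" using \<gamma> that by (simp add: hankel_contour_def)
      show "path_image (\<gamma> \<circ> linepath a b) \<subseteq> {z. z - 1 \<notin> \<real>\<^sub>\<le>\<^sub>0}"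
        using off_cut by (auto simp: path_image_def)
    qed (use deriv in \<open>auto intro: has_field_derivative_at_within\<close>)
    then show ?thesis
      by (simp add: contour_integral_unique pathstart_def pathfinish_def linepath_def)
  qed
  have "((\<lambda>s. \<Phi> (\<gamma> s)) \<longlongrightarrow> Lp) at_top" "((\<lambda>s. \<Phi> (\<gamma> s)) \<longlongrightarrow> Lm) at_bot"
    using \<gamma> by (auto intro!: filterlim_compose[OF lim(1)] filterlim_compose[OF lim(2)]
        simp: filterlim_strip_end_iff hankel_contour_def)
  from filterlim_compose[OF this(1) filterlim_snd] filterlim_compose[OF this(2) filterlim_fst]
  have "((\<lambda>x. \<Phi> (\<gamma> (snd x)) - \<Phi> (\<gamma> (fst x))) \<longlongrightarrow> Lp - Lm) (at_bot \<times>\<^sub>F at_top)"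
    by (rule tendsto_diff)
  \<comment> \<open>The two parameters move independently, but eventually a is at most 0 and b is
    positive, so the piece from a to b is a valid path.\<close>
  moreover have "\<forall>\<^sub>F x in at_bot \<times>\<^sub>F at_top.
      \<Phi> (\<gamma> (snd x)) - \<Phi> (\<gamma> (fst x)) = (case x of (a, b) \<Rightarrow> contour_integral (\<gamma> \<circ> linepath a b) f)"
    using eventually_prodI[OF eventually_le_at_bot[of "0::real"] eventually_gt_at_top[of "0::real"]]
    by eventually_elim (auto simp: int)
  ultimately show "((\<lambda>(a, b). contour_integral (\<gamma> \<circ> linepath a b) f) \<longlongrightarrow> Lp - Lm) (at_bot \<times>\<^sub>F at_top)"
    by (rule Lim_transform_eventually)
qed

section \<open>Decay of the integrands and the recurrence for G\<close>

text \<open>The modulus is exp(Re \<theta> ln |w| - Im \<theta> Arg w); the first term of the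
  exponent is nonnegative and Arg w is at most pi in modulus.\<close>

lemma norm_powr_ge:
  fixes w \<theta> :: complex
  assumes "norm w \<ge> 1" "Re \<theta> \<ge> 0"
  shows "norm (w powr \<theta>) \<ge> exp (- pi * \<bar>Im \<theta>\<bar>)"
proof -
  have w: "w \<noteq> 0" using assms(1) by auto
  have "\<bar>Im (Ln w)\<bar> \<le> pi"
    using Im_Ln_le_pi[OF w] mpi_less_Im_Ln[OF w] by auto
  then have "\<bar>Im \<theta> * Im (Ln w)\<bar> \<le> \<bar>Im \<theta>\<bar> * pi"
    unfolding abs_mult by (intro mult_left_mono) auto
  moreover have "Re \<theta> * Re (Ln w) \<ge> 0"
    using assms w by simp
  ultimately show ?thesis
    using w by (simp add: powr_def abs_le_iff mult.commute)
qed

text \<open>The signs \<open>c = 1\<close> and \<open>c = -1\<close> give the integrands of \<open>G\<close> and \<open>F\<close>, whence their common recurrence.\<close>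

lemma kernel_antiderivative:
  fixes z \<rho> \<theta> c :: complex
  assumes z: "z \<noteq> 0" "c * (z - 1) \<notin> \<real>\<^sub>\<le>\<^sub>0"
  defines "g \<equiv> \<lambda>k z. exp (\<rho> * z) / (z ^ k * (c * (z - 1)) powr \<theta>)"
  shows "((\<lambda>z. (z - 1) * g (Suc n) z) has_field_derivative
    (\<rho> * g n z + (of_nat n + 1) * g (Suc (Suc n)) z - (\<rho> + of_nat n + \<theta>) * g (Suc n) z)) (at z)"
proof -
  have nz: "c \<noteq> 0" "z - 1 \<noteq> 0" using z by auto
  have eq: "g k z = exp (\<rho> * z) * (c * (z - 1)) powr (- \<theta>) * inverse z ^ k" for k z
    by (simp add: g_def powr_minus divide_inverse power_inverse)
  have q: "(c * (z - 1)) powr (- \<theta> - 1) = (c * (z - 1)) powr (- \<theta>) / (c * (z - 1))"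
    using nz by (simp add: powr_diff)
  have "((\<lambda>z. (z - 1) * (exp (\<rho> * z) * (c * (z - 1)) powr (- \<theta>) * inverse z ^ Suc n)) has_field_derivative
     (exp (\<rho> * z) * (c * (z - 1)) powr (- \<theta>) * inverse z ^ Suc n
      + (z - 1) * ((\<rho> * exp (\<rho> * z) * (c * (z - 1)) powr (- \<theta>)
          + exp (\<rho> * z) * (- \<theta> * (c * (z - 1)) powr (- \<theta> - 1) * c)) * inverse z ^ Suc n
      + exp (\<rho> * z) * (c * (z - 1)) powr (- \<theta>) * (- (of_nat n + 1) * inverse z ^ Suc (Suc n))))) (at z)"
  proof -
    have r: "((\<lambda>z. inverse z ^ Suc n) has_field_derivative - (of_nat n + 1) * inverse z ^ Suc (Suc n)) (at z)"
      by (rule DERIV_cong[OF DERIV_power_Suc[OF DERIV_inverse[OF z(1)]]]) (simp add: algebra_simps)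
    have e: "((\<lambda>z. exp (\<rho> * z)) has_field_derivative \<rho> * exp (\<rho> * z)) (at z)"
      by (auto intro!: derivative_eq_intros)
    have p: "((\<lambda>z. (c * (z - 1)) powr (- \<theta>)) has_field_derivative - \<theta> * (c * (z - 1)) powr (- \<theta> - 1) * c) (at z)"
      by (rule DERIV_chain2[where f = "\<lambda>w. w powr (- \<theta>)" and g = "\<lambda>z. c * (z - 1)", OF has_field_derivative_powr[OF z(2)]]) (auto intro!: derivative_eq_intros)
    have s: "((\<lambda>z. z - 1) has_field_derivative 1) (at z)"
      by (auto intro!: derivative_eq_intros)
    show ?thesis
      by (rule DERIV_cong[OF DERIV_mult[OF s DERIV_mult[OF DERIV_mult[OF e p] r]]]) (simp add: algebra_simps)
  qed
  also have "(exp (\<rho> * z) * (c * (z - 1)) powr (- \<theta>) * inverse z ^ Suc n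
      + (z - 1) * ((\<rho> * exp (\<rho> * z) * (c * (z - 1)) powr (- \<theta>)
          + exp (\<rho> * z) * (- \<theta> * (c * (z - 1)) powr (- \<theta> - 1) * c)) * inverse z ^ Suc n
      + exp (\<rho> * z) * (c * (z - 1)) powr (- \<theta>) * (- (of_nat n + 1) * inverse z ^ Suc (Suc n))))
     = \<rho> * g n z + (of_nat n + 1) * g (Suc (Suc n)) z - (\<rho> + of_nat n + \<theta>) * g (Suc n) z"
  proof -
    \<comment> \<open>With t for 1/z, and q and y for the powers with exponents -\<theta> and
      -\<theta> - 1, the identity is polynomial modulo the two stated relations.\<close>
    have gen: "e * q * (t * x) + (z - 1) * ((\<rho> * e * q + e * (- \<theta> * y * c)) * (t * x) + e * q * (- (k + 1) * (t * (t * x))))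
        = \<rho> * (e * q * x) + (k + 1) * (e * q * (t * (t * x))) - (\<rho> + k + \<theta>) * (e * q * (t * x))"
      if "z * t = 1" "(z - 1) * (y * c) = q" for e q t x y k :: complex
      using that by algebra
    show ?thesis
      unfolding eq power_Suc by (rule gen) (use nz z q in auto)
  qed
  finally show ?thesis unfolding eq .
qed

lemma kernel_bound:
  assumes "Re z \<le> -1" "Re \<theta> \<ge> 0"
  shows "norm (exp (of_real \<rho> * z) / (z ^ k * (z - 1) powr \<theta>)) \<le> exp (pi * \<bar>Im \<theta>\<bar>) * exp (\<rho> * Re z) / norm z ^ k"
    and "norm z \<ge> 1"
proof -
  show nz: "norm z \<ge> 1" using abs_Re_le_cmod[of z] assms by linarith
  have "norm (z - 1) \<ge> 1" using abs_Re_le_cmod[of "z - 1"] assms by simp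
  from norm_powr_ge[OF this assms(2)]
  have "inverse (norm ((z - 1) powr \<theta>)) \<le> inverse (exp (- pi * \<bar>Im \<theta>\<bar>))"
    by (intro le_imp_inverse_le) auto
  then have "norm ((z - 1) powr - \<theta>) \<le> exp (pi * \<bar>Im \<theta>\<bar>)"
    by (simp add: exp_minus powr_minus norm_inverse)
  then have "exp (\<rho> * Re z) / norm z ^ k * norm ((z - 1) powr - \<theta>) \<le> exp (\<rho> * Re z) / norm z ^ k * exp (pi * \<bar>Im \<theta>\<bar>)"
    by (intro mult_left_mono) auto
  then show "norm (exp (of_real \<rho> * z) / (z ^ k * (z - 1) powr \<theta>)) \<le> exp (pi * \<bar>Im \<theta>\<bar>) * exp (\<rho> * Re z) / norm z ^ k"
    by (simp add: norm_divide norm_mult norm_power powr_minus norm_inverse field_simps)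
qed

text \<open>The slit plane is starlike about 2, which yields the primitive. A strip of half-width
  |y| around a height y other than 0 misses the slit, and there the integrand decays like exp(\<rho>
  Re z), which yields the limits.\<close>

lemma special_G_primitive:
  fixes k :: nat and \<rho> :: real and \<theta> :: complex
  assumes "\<rho> > 0" "Re \<theta> \<ge> 0"
  defines "g \<equiv> \<lambda>z. exp (complex_of_real \<rho> * z) / (z ^ k * (z - 1) powr \<theta>)"
  obtains \<Phi> where "\<And>z. z - 1 \<notin> \<real>\<^sub>\<le>\<^sub>0 \<Longrightarrow> (\<Phi> has_field_derivative g z) (at z)"
    "\<And>y. y \<noteq> 0 \<Longrightarrow> \<exists>L. (\<Phi> \<longlongrightarrow> L) (strip_end y)"
proof -
  let ?S = "{z :: complex. z - 1 \<notin> \<real>\<^sub>\<le>\<^sub>0}"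
  have S_eq: "?S = (\<lambda>z. z - 1) -` (- \<real>\<^sub>\<le>\<^sub>0)" by auto
  have opS: "open ?S"
    unfolding S_eq by (intro continuous_open_vimage) (auto intro!: continuous_intros)
  have star: "starlike ?S"
    unfolding starlike_def
  proof (intro bexI[of _ 2] ballI)
    fix z assume z: "z \<in> ?S"
    show "closed_segment 2 z \<subseteq> ?S"
    proof
      fix w assume "w \<in> closed_segment 2 z"
      then obtain u where u: "0 \<le> u" "u \<le> 1" "w = (1 - u) *\<^sub>R 2 + u *\<^sub>R z"
        by (auto simp: closed_segment_def)
      have ww: "Re w - 1 = (1 - u) + u * (Re z - 1)" "Im w = u * Im z" using arg_cong[OF u(3), of Re] arg_cong[OF u(3), of Im] by (simp_all add: algebra_simps)
      have "\<not> (Re w - 1 \<le> 0 \<and> Im w = 0)"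
      proof
        assume a: "Re w - 1 \<le> 0 \<and> Im w = 0"
        then consider "u = 0" | "Im z = 0" "u > 0" using ww u by fastforce
        then show False
        proof cases
          case 2
          then have "Re z - 1 > 0" using z by (auto simp: complex_nonpos_Reals_iff)
          then have "u * (Re z - 1) > 0" using 2 by simp
          then show False using a ww u by linarith
        qed (use a ww in auto)
      qed
      then show "w \<in> ?S" by (auto simp: complex_nonpos_Reals_iff)
    qed
  qed (simp add: complex_nonpos_Reals_iff)
  have nz: "z \<noteq> 0" "z \<noteq> 1" if "z \<in> ?S" for z
    using that by (auto simp: complex_nonpos_Reals_iff)
  have "g field_differentiable at z" if "z \<in> ?S" for z
  proof -
    have "g holomorphic_on ?S"
      unfolding g_def by (intro holomorphic_intros) (auto dest: nz)
    then show ?thesis using opS that by (rule holomorphic_on_imp_differentiable_at)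
  qed
  moreover from this have "continuous_on ?S g"
    by (intro continuous_at_imp_continuous_on ballI field_differentiable_imp_continuous_at)
  ultimately obtain \<Phi> where \<Phi>: "\<And>z. z \<in> ?S \<Longrightarrow> (\<Phi> has_field_derivative g z) (at z)"
    using holomorphic_starlike_primitive[OF _ star opS, of g "{}"] by auto
  have "\<exists>L. (\<Phi> \<longlongrightarrow> L) (strip_end y)" if "y \<noteq> 0" for y
  proof (rule strip_convergent[where X = "-1" and d = "\<bar>y\<bar>" and f = g and C = "exp (pi * \<bar>Im \<theta>\<bar>)" and a = \<rho>])
    fix z assume z: "Re z < -1" "\<bar>Im z - y\<bar> < \<bar>y\<bar>"
    then have "Im z \<noteq> 0" by auto
    then show "(\<Phi> has_field_derivative g z) (at z)" by (intro \<Phi>) (auto simp: complex_nonpos_Reals_iff)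
    have "norm z \<ge> 1" "norm (g z) \<le> exp (pi * \<bar>Im \<theta>\<bar>) * exp (\<rho> * Re z) / norm z ^ k"
      using kernel_bound(1)[of z \<theta> \<rho> k] kernel_bound(2)[of z \<theta>] z assms by (auto simp: g_def)
    moreover from this(1) have "exp (pi * \<bar>Im \<theta>\<bar>) * exp (\<rho> * Re z) / norm z ^ k \<le> exp (pi * \<bar>Im \<theta>\<bar>) * exp (\<rho> * Re z) / 1"
      by (intro divide_left_mono mult_pos_pos zero_less_power) (auto intro: one_le_power simp del: zero_less_norm_iff)
    ultimately show "norm (g z) \<le> exp (pi * \<bar>Im \<theta>\<bar>) * exp (\<rho> * Re z)" by simp
  qed (use \<open>\<rho> > 0\<close> that in auto)
  with \<Phi> show ?thesis using that by blast
qed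

text \<open>The matching combination of integrands is the derivative of
  \<open>(z - 1) * g (Suc n) z\<close>, which tends to 0 at both ends of the contour. The
  combination of the integrals is therefore 0.\<close>

lemma special_G_recurrence:
  assumes \<gamma>: "hankel_contour \<epsilon> \<gamma>" and "\<rho> > 0" "Re \<theta> > 0"
  shows "(of_nat n + 1) * special_G \<gamma> \<rho> \<theta> (int n + 1) =
    (of_real \<rho> + of_nat n + \<theta>) * special_G \<gamma> \<rho> \<theta> (int n) - of_real \<rho> * special_G \<gamma> \<rho> \<theta> (int n - 1)"
proof -
  define g where "g = (\<lambda>k z. exp (complex_of_real \<rho> * z) / (z ^ k * (z - 1) powr \<theta>))"
  have \<epsilon>: "\<epsilon> > 0" using \<gamma> by (simp add: hankel_contour_def)
  have "\<exists>\<Phi> Lp Lm. (\<forall>z. z - 1 \<notin> \<real>\<^sub>\<le>\<^sub>0 \<longrightarrow> (\<Phi> has_field_derivative g k z) (at z)) \<and>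
     (\<Phi> \<longlongrightarrow> Lp) (strip_end \<epsilon>) \<and> (\<Phi> \<longlongrightarrow> Lm) (strip_end (- \<epsilon>))" for k
  proof (rule special_G_primitive[where \<rho> = \<rho> and \<theta> = \<theta> and k = k])
    fix \<Phi> assume *: "\<And>z. z - 1 \<notin> \<real>\<^sub>\<le>\<^sub>0 \<Longrightarrow> (\<Phi> has_field_derivative exp (of_real \<rho> * z) / (z ^ k * (z - 1) powr \<theta>)) (at z)"
      "\<And>y. y \<noteq> 0 \<Longrightarrow> \<exists>L. (\<Phi> \<longlongrightarrow> L) (strip_end y)"
    from *(2)[of \<epsilon>] *(2)[of "- \<epsilon>"] \<epsilon> *(1) show ?thesis unfolding g_def by auto
  qed (use assms in auto)
  then obtain \<Phi> Lp Lm where \<Phi>: "\<And>k z. z - 1 \<notin> \<real>\<^sub>\<le>\<^sub>0 \<Longrightarrow> (\<Phi> k has_field_derivative g k z) (at z)"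
    and L: "\<And>k. (\<Phi> k \<longlongrightarrow> Lp k) (strip_end \<epsilon>)" "\<And>k. (\<Phi> k \<longlongrightarrow> Lm k) (strip_end (- \<epsilon>))"
    by metis
  \<comment> \<open>The index \<open>int k - 1\<close> turns the exponent n + 1 of the integrand
    into the natural number k, with G_(-1) at k = 0.\<close>
  have G: "special_G \<gamma> \<rho> \<theta> (int k - 1) = 1 / (2 * of_real pi * \<i>) * (Lp k - Lm k)" for k
    using improper_contour_integral_primitive[OF \<gamma> \<Phi>[where k = k] L(1)[of k] L(2)[of k]] by (simp add: special_G_def g_def)
  let ?h = "\<lambda>z. of_real \<rho> * g n z + (of_nat n + 1) * g (Suc (Suc n)) z - (of_real \<rho> + of_nat n + \<theta>) * g (Suc n) z"
  have "improper_contour_integral \<gamma> ?h =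
      (of_real \<rho> * Lp n + (of_nat n + 1) * Lp (Suc (Suc n)) - (of_real \<rho> + of_nat n + \<theta>) * Lp (Suc n))
    - (of_real \<rho> * Lm n + (of_nat n + 1) * Lm (Suc (Suc n)) - (of_real \<rho> + of_nat n + \<theta>) * Lm (Suc n))"
  proof (rule improper_contour_integral_primitive[OF \<gamma>])
    let ?F = "\<lambda>z. of_real \<rho> * \<Phi> n z + (of_nat n + 1) * \<Phi> (Suc (Suc n)) z
      - (of_real \<rho> + of_nat n + \<theta>) * \<Phi> (Suc n) z"
    show "(?F has_field_derivative ?h z) (at z)" if "z - 1 \<notin> \<real>\<^sub>\<le>\<^sub>0" for z
      by (rule DERIV_diff DERIV_add DERIV_cmult \<Phi>[OF that])+
    show "(?F \<longlongrightarrow> of_real \<rho> * Lp n + (of_nat n + 1) * Lp (Suc (Suc n)) - (of_real \<rho> + of_nat n + \<theta>) * Lp (Suc n)) (strip_end \<epsilon>)"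
      "(?F \<longlongrightarrow> of_real \<rho> * Lm n + (of_nat n + 1) * Lm (Suc (Suc n)) - (of_real \<rho> + of_nat n + \<theta>) * Lm (Suc n)) (strip_end (- \<epsilon>))"
      by (rule tendsto_diff tendsto_add tendsto_mult tendsto_const L)+
  qed
  moreover have "improper_contour_integral \<gamma> ?h = 0 - 0"
  proof (rule improper_contour_integral_primitive[OF \<gamma>, where \<Phi> = "\<lambda>z. (z - 1) * g (Suc n) z"])
    show "((\<lambda>z. (z - 1) * g (Suc n) z) has_field_derivative ?h z) (at z)" if "z - 1 \<notin> \<real>\<^sub>\<le>\<^sub>0" for z
    proof -
      have "z \<noteq> 0" using that by auto
      then show ?thesis
        using kernel_antiderivative[where z = z and c = 1 and \<rho> = "of_real \<rho>" and \<theta> = \<theta> and n = n] that by (simp add: g_def)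
    qed
    have "((\<lambda>z. (z - 1) * g (Suc n) z) \<longlongrightarrow> 0) (strip_end y)" for y
    proof (rule Lim_null_comparison)
      show "((\<lambda>z. 2 * exp (pi * \<bar>Im \<theta>\<bar>) * exp (\<rho> * Re z)) \<longlongrightarrow> 0) (strip_end y)"
        by (rule tendsto_mult_right_zero[OF exp_Re_strip_end[OF \<open>\<rho> > 0\<close>]])
      show "\<forall>\<^sub>F z in strip_end y. norm ((z - 1) * g (Suc n) z) \<le> 2 * exp (pi * \<bar>Im \<theta>\<bar>) * exp (\<rho> * Re z)"
        using eventually_strip_end_Re[where x = "-1"]
      proof eventually_elim
        fix z assume "Re z < -1"
        then have b: "norm z \<ge> 1" "norm (g (Suc n) z) \<le> exp (pi * \<bar>Im \<theta>\<bar>) * exp (\<rho> * Re z) / norm z ^ Suc n"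
          using kernel_bound(1)[of z \<theta> \<rho> "Suc n"] kernel_bound(2)[of z \<theta>] assms by (auto simp: g_def)
        have "norm ((z - 1) * g (Suc n) z) \<le> (2 * norm z ^ Suc n) * (exp (pi * \<bar>Im \<theta>\<bar>) * exp (\<rho> * Re z) / norm z ^ Suc n)"
          unfolding norm_mult
        proof (intro mult_mono b)
          have "norm (z - 1) \<le> 2 * norm z" using norm_triangle_ineq4[of z 1] b(1) by simp
          also have "\<dots> \<le> 2 * norm z ^ Suc n" using self_le_power[OF b(1), of "Suc n"] by simp
          finally show "norm (z - 1) \<le> 2 * norm z ^ Suc n" .
        qed auto
        also have "\<dots> = 2 * exp (pi * \<bar>Im \<theta>\<bar>) * exp (\<rho> * Re z)" using b(1) by auto
        finally show "norm ((z - 1) * g (Suc n) z) \<le> 2 * exp (pi * \<bar>Im \<theta>\<bar>) * exp (\<rho> * Re z)" .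
      qed
    qed
    then show "((\<lambda>z. (z - 1) * g (Suc n) z) \<longlongrightarrow> 0) (strip_end \<epsilon>)" "((\<lambda>z. (z - 1) * g (Suc n) z) \<longlongrightarrow> 0) (strip_end (- \<epsilon>))" by blast+
  qed
  ultimately have rel: "(of_real \<rho> * Lp n + (of_nat n + 1) * Lp (Suc (Suc n)) - (of_real \<rho> + of_nat n + \<theta>) * Lp (Suc n))
    - (of_real \<rho> * Lm n + (of_nat n + 1) * Lm (Suc (Suc n)) - (of_real \<rho> + of_nat n + \<theta>) * Lm (Suc n)) = 0"
    by simp
  define c where "c = 1 / (2 * of_real pi * \<i>)"
  have "special_G \<gamma> \<rho> \<theta> (int n - 1) = c * (Lp n - Lm n)"
    "special_G \<gamma> \<rho> \<theta> (int n) = c * (Lp (Suc n) - Lm (Suc n))"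
    "special_G \<gamma> \<rho> \<theta> (int n + 1) = c * (Lp (Suc (Suc n)) - Lm (Suc (Suc n)))"
    using G[of n] G[of "Suc n"] G[of "Suc (Suc n)"] by (simp_all add: c_def add.commute)
  with rel show ?thesis by algebra
qed

section \<open>Hankel's integral for the reciprocal Gamma function\<close>

text \<open>Hankel's formula, expressed as the jump of a primitive between the two ends of the slit.
  The limits are common to all heights y, since the later substitution w = \<rho> (z - 1) changes
  the height \<epsilon> into \<rho> \<epsilon>.\<close>

definition hankel_primitive :: "complex \<Rightarrow> (complex \<Rightarrow> complex) \<Rightarrow> bool" where
  "hankel_primitive \<theta> \<Phi> \<longleftrightarrow>
     (\<forall>w. w \<notin> \<real>\<^sub>\<le>\<^sub>0 \<longrightarrow> (\<Phi> has_field_derivative exp w / w powr \<theta>) (at w)) \<and>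
     (\<exists>Lp Lm. (\<forall>y>0. (\<Phi> \<longlongrightarrow> Lp) (strip_end y) \<and> (\<Phi> \<longlongrightarrow> Lm) (strip_end (- y))) \<and>
        Lp - Lm = 2 * of_real pi * \<i> * rGamma \<theta>)"

lemma hankel_primitiveI:
  assumes "\<And>w. w \<notin> \<real>\<^sub>\<le>\<^sub>0 \<Longrightarrow> (\<Phi> has_field_derivative exp w / w powr \<theta>) (at w)"
    and "\<And>y. y > 0 \<Longrightarrow> (\<Phi> \<longlongrightarrow> Lp) (strip_end y)" "\<And>y. y > 0 \<Longrightarrow> (\<Phi> \<longlongrightarrow> Lm) (strip_end (- y))"
    and "Lp - Lm = 2 * of_real pi * \<i> * rGamma \<theta>"
  shows "hankel_primitive \<theta> \<Phi>"
  using assms unfolding hankel_primitive_def by blast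

lemma norm_exp_div_powr_le:
  fixes w x \<theta> :: complex
  assumes "norm w \<ge> 1" "Re \<theta> \<ge> 0"
  shows "norm (exp x / w powr \<theta>) \<le> exp (pi * \<bar>Im \<theta>\<bar>) * exp (Re x)"
proof -
  have "norm (exp x) / norm (w powr \<theta>) \<le> norm (exp x) / exp (- pi * \<bar>Im \<theta>\<bar>)"
    by (intro divide_left_mono norm_powr_ge assms mult_pos_pos
          order.strict_trans2[OF exp_gt_zero norm_powr_ge[OF assms]]) auto
  then show ?thesis
    by (simp add: norm_divide norm_mult norm_inverse exp_minus divide_inverse mult.commute)
qed

lemma exp_powr_strip_end:
  assumes "Re \<theta> \<ge> 0"
  shows "((\<lambda>w. exp w / w powr \<theta>) \<longlongrightarrow> 0) (strip_end y)"
proof (rule Lim_null_comparison)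
  show "((\<lambda>w. exp (pi * \<bar>Im \<theta>\<bar>) * exp (1 * Re w)) \<longlongrightarrow> 0) (strip_end y)"
    by (rule tendsto_mult_right_zero[OF exp_Re_strip_end]) simp
  show "\<forall>\<^sub>F w in strip_end y. norm (exp w / w powr \<theta>) \<le> exp (pi * \<bar>Im \<theta>\<bar>) * exp (1 * Re w)"
    using eventually_strip_end_Re[where x = "-1"]
  proof eventually_elim
    fix w assume "Re w < -1"
    then have "norm w \<ge> 1" using abs_Re_le_cmod[of w] by linarith
    from norm_exp_div_powr_le[OF this assms, of w]
    show "norm (exp w / w powr \<theta>) \<le> exp (pi * \<bar>Im \<theta>\<bar>) * exp (1 * Re w)" by simp
  qed
qed

text \<open>Integration by parts: the boundary term exp w / w^\<theta> vanishes at both ends, so the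
  jump is merely divided by \<theta>, as in the functional equation of
  \<open>rGamma\<close>.\<close>

lemma hankel_primitive_add1:
  assumes "hankel_primitive \<theta> \<Phi>" "\<theta> \<noteq> 0" "Re \<theta> \<ge> 0"
  shows "hankel_primitive (\<theta> + 1) (\<lambda>w. (\<Phi> w - exp w / w powr \<theta>) / \<theta>)"
proof -
  obtain Lp Lm where L: "\<And>y. y > 0 \<Longrightarrow> (\<Phi> \<longlongrightarrow> Lp) (strip_end y)" "\<And>y. y > 0 \<Longrightarrow> (\<Phi> \<longlongrightarrow> Lm) (strip_end (- y))"
    and diff: "Lp - Lm = 2 * of_real pi * \<i> * rGamma \<theta>"
    using assms(1) by (auto simp: hankel_primitive_def)
  show ?thesis
  proof (rule hankel_primitiveI[where Lp = "(Lp - 0) / \<theta>" and Lm = "(Lm - 0) / \<theta>"])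
    fix w :: complex assume w: "w \<notin> \<real>\<^sub>\<le>\<^sub>0"
    then have nz: "w \<noteq> 0" by auto
    have d: "(\<Phi> has_field_derivative exp w / w powr \<theta>) (at w)"
      using assms(1) w by (auto simp: hankel_primitive_def)
    have q: "w powr (- \<theta> - 1) = w powr (- \<theta>) / w" "w powr (\<theta> + 1) = w powr \<theta> * w"
      using nz by (simp_all add: powr_diff powr_add)
    have "((\<lambda>w. (\<Phi> w - exp w * w powr (- \<theta>)) / \<theta>) has_field_derivative
        (exp w / w powr \<theta> - (exp w * w powr (- \<theta>) + (- \<theta> * w powr (- \<theta> - 1)) * exp w)) / \<theta>) (at w)"
      by (intro DERIV_cdivide DERIV_diff DERIV_mult d DERIV_exp has_field_derivative_powr w)
    also have "(exp w / w powr \<theta> - (exp w * w powr (- \<theta>) + (- \<theta> * w powr (- \<theta> - 1)) * exp w)) / \<theta> = exp w / w powr (\<theta> + 1)"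
      unfolding q using nz assms(2) by (simp add: powr_minus field_simps)
    finally show "((\<lambda>w. (\<Phi> w - exp w / w powr \<theta>) / \<theta>) has_field_derivative exp w / w powr (\<theta> + 1)) (at w)"
      by (simp add: powr_minus divide_inverse)
  next
    show "(Lp - 0) / \<theta> - (Lm - 0) / \<theta> = 2 * of_real pi * \<i> * rGamma (\<theta> + 1)"
      using diff rGamma_plus1[of \<theta>] assms(2) by (simp add: field_simps diff_divide_distrib[symmetric])
  next
    fix y :: real assume y: "y > 0"
    show "((\<lambda>w. (\<Phi> w - exp w / w powr \<theta>) / \<theta>) \<longlongrightarrow> (Lp - 0) / \<theta>) (strip_end y)"
      "((\<lambda>w. (\<Phi> w - exp w / w powr \<theta>) / \<theta>) \<longlongrightarrow> (Lm - 0) / \<theta>) (strip_end (- y))"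
      by (intro tendsto_divide tendsto_diff L[OF y] exp_powr_strip_end tendsto_const assms)+
  qed
qed

text \<open>Far to the left -z lies in the right half-plane, away from the cut, so the two sides of
  the cut differ only in the sign of the added constant.\<close>

lemma Ln_reflect:
  assumes "Im z \<noteq> 0"
  shows "Ln z = Ln (- z) + (if Im z > 0 then \<i> * pi else - (\<i> * pi))"
  using Ln_minus[of "- z"] assms by (cases "z = 0") auto

text \<open>The lower incomplete Gamma function on the right half-plane: on both sides of the cut the
  primitive of the Hankel integrand is, up to a constant, this function at \<open>- z\<close>, so both
  ends of the contour are governed by one and the same limit.\<close>

lemma incomplete_Gamma_limit:
  assumes deriv: "\<And>u. Re u > 0 \<Longrightarrow> (\<Psi> has_field_derivative exp (- u) / u powr \<theta>) (at u)"
    and \<theta>: "Re \<theta> \<ge> 0"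
  obtains L where "((\<lambda>x. \<Psi> (complex_of_real x)) \<longlongrightarrow> L) at_top"
    "\<And>y. ((\<lambda>z. \<Psi> (- z)) \<longlongrightarrow> L) (strip_end y)"
proof -
  let ?C = "exp (pi * \<bar>Im \<theta>\<bar>)"
  have bound: "norm (exp (- u) / u powr \<theta>) \<le> ?C * exp (- Re u)" if "Re u \<ge> 1" for u
  proof -
    have "norm u \<ge> 1" using abs_Re_le_cmod[of u] that by linarith
    from norm_exp_div_powr_le[OF this \<theta>, of "- u"] show ?thesis by simp
  qed
  have dm: "((\<lambda>z. \<Psi> (- z)) has_field_derivative - (exp z / (- z) powr \<theta>)) (at z)" if "Re z < 0" for z
    using DERIV_chain2[where f = \<Psi> and g = uminus, OF deriv[of "- z"] DERIV_minus[OF DERIV_ident]] that by simp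
  have "\<exists>L. ((\<lambda>z. \<Psi> (- z)) \<longlongrightarrow> L) (strip_end 0)"
  proof (rule strip_convergent[where X = "-1" and d = 1 and a = 1 and C = ?C])
    show "norm (- (exp z / (- z) powr \<theta>)) \<le> ?C * exp (1 * Re z)" if "Re z < -1" for z
      using bound[of "- z"] that by simp
    show "((\<lambda>z. \<Psi> (- z)) has_field_derivative - (exp z / (- z) powr \<theta>)) (at z)" if "Re z < -1" for z
      by (rule dm) (use that in simp)
  qed auto
  then obtain L where L: "((\<lambda>z. \<Psi> (- z)) \<longlongrightarrow> L) (strip_end 0)" ..
  have "filterlim (\<lambda>x. - complex_of_real x) (strip_end 0) at_top"
    by (simp add: filterlim_strip_end_iff filterlim_uminus_at_bot_at_top)
  from filterlim_compose[OF L this] have real: "((\<lambda>x. \<Psi> (complex_of_real x)) \<longlongrightarrow> L) at_top" by simp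
  \<comment> \<open>At any height, the value at -z is compared with the one at the real point -Re z:
    they differ by at most |Im z| times the bound of the derivative on the half-plane to the right,
    which tends to 0.\<close>
  moreover have "((\<lambda>z. \<Psi> (- z)) \<longlongrightarrow> L) (strip_end y)" for y
  proof -
    have "((\<lambda>z. \<Psi> (of_real (- Re z))) \<longlongrightarrow> L) (strip_end y)"
      by (rule filterlim_compose[OF real]) (use strip_end_Re filterlim_uminus_at_top_at_bot filterlim_compose in \<open>blast\<close>)
    moreover have "((\<lambda>z. \<Psi> (- z) - \<Psi> (of_real (- Re z))) \<longlongrightarrow> 0) (strip_end y)"
    proof (rule Lim_null_comparison)
      have "((\<lambda>z. ?C * exp (1 * Re z) * \<bar>Im z\<bar>) \<longlongrightarrow> ?C * 0 * \<bar>y\<bar>) (strip_end y)"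
        by (intro tendsto_intros exp_Re_strip_end strip_end_Im) auto
      then show "((\<lambda>z. ?C * exp (1 * Re z) * \<bar>Im z\<bar>) \<longlongrightarrow> 0) (strip_end y)" by simp
      show "\<forall>\<^sub>F z in strip_end y. norm (\<Psi> (- z) - \<Psi> (of_real (- Re z))) \<le> ?C * exp (1 * Re z) * \<bar>Im z\<bar>"
        using eventually_strip_end_Re[where x = "-1"]
      proof eventually_elim
        fix z assume z: "Re z < -1"
        have "norm (\<Psi> (- z) - \<Psi> (of_real (- Re z))) \<le> (?C * exp (1 * Re z)) * norm (- z - of_real (- Re z))"
        proof (rule field_differentiable_bound[where S = "{u. Re u \<ge> - Re z}" and f' = "\<lambda>u. exp (- u) / u powr \<theta>"])
          fix u assume u: "u \<in> {u. Re u \<ge> - Re z}"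
          show "(\<Psi> has_field_derivative exp (- u) / u powr \<theta>) (at u within {u. Re u \<ge> - Re z})"
            by (rule has_field_derivative_at_within[OF deriv]) (use u z in auto)
          have "norm (exp (- u) / u powr \<theta>) \<le> ?C * exp (- Re u)" using bound[of u] u z by simp
          also have "\<dots> \<le> ?C * exp (1 * Re z)" using u by (intro mult_left_mono) auto
          finally show "norm (exp (- u) / u powr \<theta>) \<le> ?C * exp (1 * Re z)" .
        qed (auto simp: convex_halfspace_Re_ge)
        also have "- z - of_real (- Re z) = - (\<i> * of_real (Im z))" by (simp add: complex_eq_iff)
        finally show "norm (\<Psi> (- z) - \<Psi> (of_real (- Re z))) \<le> ?C * exp (1 * Re z) * \<bar>Im z\<bar>"
          by (simp add: norm_mult)
      qed
    qed
    ultimately show ?thesis by (rule Lim_transform)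
  qed
  ultimately show ?thesis using that by blast
qed

lemma strip_end_upper: "y > 0 \<Longrightarrow> \<forall>\<^sub>F z in strip_end y. Im z > 0"
  and strip_end_lower: "y > 0 \<Longrightarrow> \<forall>\<^sub>F z in strip_end (- y). Im z < 0"
  using order_tendstoD[OF strip_end_Im] by fastforce+

text \<open>The exponential integral. This exponent needs its own primitive: integrating the series
  termwise produces a logarithm from its first term, and integration by parts starting at \<theta> =
  0 would divide by 0.\<close>

lemma hankel_primitive_1: "\<exists>\<Phi>. hankel_primitive 1 \<Phi>"
proof -
  \<comment> \<open>What remains of exp w / w after subtracting 1 / w, with the removable
    singularity filled in; being entire, it has a primitive E on the whole plane.\<close>
  define h where "h = (\<lambda>w::complex. if w = 0 then 1 else (exp w - 1) / w)"
  have h_at: "(h has_field_derivative (exp w * w - (exp w - 1) * 1) / (w * w)) (at w)" if "w \<noteq> 0" for w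
  proof (rule has_field_derivative_transform_within_open[where S = "- {0}" and f = "\<lambda>w. (exp w - 1) / w"])
    have "((\<lambda>w. exp w - 1) has_field_derivative exp w) (at w)" by (auto intro!: derivative_eq_intros)
    from DERIV_divide[OF this DERIV_ident that]
    show "((\<lambda>w. (exp w - 1) / w) has_field_derivative (exp w * w - (exp w - 1) * 1) / (w * w)) (at w)" by simp
  qed (use that in \<open>auto simp: h_def\<close>)
  have "((\<lambda>w::complex. (exp w - 1) / w) \<longlongrightarrow> 1) (at 0)"
    using DERIV_exp[of "0::complex"] by (simp add: has_field_derivative_iff)
  then have "(h \<longlongrightarrow> h 0) (at 0)"
    by (subst LIM_equal[where g = "\<lambda>w. (exp w - 1) / w"]) (auto simp: h_def)
  then have "isCont h 0" by (simp add: isCont_def)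
  then have cont: "continuous_on UNIV h"
    using h_at DERIV_isCont by (metis continuous_at_imp_continuous_on)
  obtain E where E: "\<And>w. w \<in> UNIV \<Longrightarrow> (E has_field_derivative h w) (at w within UNIV)"
    by (rule holomorphic_convex_primitive[OF convex_UNIV _ cont, of "{0}"])
       (use h_at in \<open>auto simp: field_differentiable_def\<close>)
  define \<Phi> where "\<Phi> = (\<lambda>w. Ln w + E w)"
  have \<Phi>: "(\<Phi> has_field_derivative exp w / w) (at w)" if "w \<notin> \<real>\<^sub>\<le>\<^sub>0" for w
  proof -
    have nz: "w \<noteq> 0" using that by auto
    have "(\<Phi> has_field_derivative inverse w + h w) (at w)"
      unfolding \<Phi>_def by (intro DERIV_add has_field_derivative_Ln that) (use E in auto)
    also have "inverse w + h w = exp w / w" using nz by (simp add: h_def field_simps)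
    finally show ?thesis .
  qed
  define \<Psi> where "\<Psi> = (\<lambda>u. Ln u + E (- u))"
  have \<Psi>: "(\<Psi> has_field_derivative exp (- u) / u powr 1) (at u)" if "Re u > 0" for u
  proof -
    have nz: "u \<noteq> 0" "u \<notin> \<real>\<^sub>\<le>\<^sub>0" using that by (auto simp: complex_nonpos_Reals_iff)
    have "(\<Psi> has_field_derivative inverse u + h (- u) * (- 1)) (at u)"
      unfolding \<Psi>_def
      by (intro DERIV_add has_field_derivative_Ln nz DERIV_chain2[where f = E and g = uminus] DERIV_minus DERIV_ident)
         (use E in auto)
    also have "inverse u + h (- u) * (- 1) = exp (- u) / u powr 1" using nz by (simp add: h_def field_simps)
    finally show ?thesis .
  qed
  \<comment> \<open>The value of L cancels in the jump, which is the difference 2 pi i of the two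
    logarithms.\<close>
  obtain L where L: "\<And>y. ((\<lambda>z. \<Psi> (- z)) \<longlongrightarrow> L) (strip_end y)"
    by (rule incomplete_Gamma_limit[of \<Psi> 1]) (use \<Psi> in auto)
  have eq: "\<Phi> z = \<Psi> (- z) + (if Im z > 0 then \<i> * pi else - (\<i> * pi))" if "Im z \<noteq> 0" for z
    using Ln_reflect[OF that] by (simp add: \<Phi>_def \<Psi>_def)
  have up: "(\<Phi> \<longlongrightarrow> L + \<i> * pi) (strip_end y)" if "y > 0" for y
    by (rule Lim_transform_eventually[OF tendsto_add[OF L tendsto_const]])
       (use strip_end_upper[OF that] in \<open>eventually_elim, auto simp: eq\<close>)
  have low: "(\<Phi> \<longlongrightarrow> L + - (\<i> * pi)) (strip_end (- y))" if "y > 0" for y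
    by (rule Lim_transform_eventually[OF tendsto_add[OF L tendsto_const]])
       (use strip_end_lower[OF that] in \<open>eventually_elim, auto simp: eq\<close>)
  have "hankel_primitive 1 \<Phi>"
    by (rule hankel_primitiveI[OF _ up low]) (use \<Phi> in auto)
  then show ?thesis by blast
qed

text \<open>For Re \<theta> < 1 the primitive can be started at 0 and is an incomplete Gamma
  function up to a phase on either side of the cut. Its limit there is Gamma(1 - \<theta>) times
  that phase; the difference of the phases is a sine, and the reflection formula turns the product
  into \<open>rGamma\<close>.\<close>

lemma hankel_primitive_base:
  assumes \<theta>: "0 \<le> Re \<theta>" "Re \<theta> < 1"
  shows "\<exists>\<Phi>. hankel_primitive \<theta> \<Phi>"
proof -
  have k: "norm (of_nat k + 1 - \<theta>) \<ge> 1 - Re \<theta>" for k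
    using abs_Re_le_cmod[of "of_nat k + 1 - \<theta>"] by simp
  have knz: "of_nat k + 1 - \<theta> \<noteq> 0" for k using k[of k] \<theta> by auto
  \<comment> \<open>Termwise integration of exp z / z^\<theta> gives z^(1 - \<theta>) times the
    power series with these coefficients.\<close>
  define c where "c = (\<lambda>k. 1 / (fact k * (of_nat k + 1 - \<theta>)))"
  have summ: "summable (\<lambda>k. c k * z ^ k)" for z
  proof (rule summable_comparison_test)
    show "summable (\<lambda>k. 1 / (1 - Re \<theta>) * (norm z ^ k /\<^sub>R fact k))"
      by (intro summable_mult summable_exp_generic)
    have "norm (c k * z ^ k) \<le> 1 / (1 - Re \<theta>) * (norm z ^ k /\<^sub>R fact k)" for k
    proof -
      have "norm z ^ k / fact k / norm (of_nat k + 1 - \<theta>) \<le> norm z ^ k / fact k / (1 - Re \<theta>)"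
        using k[of k] \<theta> by (intro divide_left_mono mult_pos_pos) auto
      moreover have "norm (c k * z ^ k) = norm z ^ k / fact k / norm (of_nat k + 1 - \<theta>)"
        by (simp only: c_def norm_mult norm_divide norm_power norm_one norm_fact) simp
      ultimately show ?thesis by (simp add: divide_inverse mult.commute)
    qed
    then show "\<exists>N. \<forall>n\<ge>N. norm (c n * z ^ n) \<le> 1 / (1 - Re \<theta>) * (norm z ^ n /\<^sub>R fact n)" by blast
  qed
  define E where "E = (\<lambda>z. \<Sum>k. c k * z ^ k)"
  define E' where "E' = (\<lambda>z. \<Sum>k. diffs c k * z ^ k)"
  have E: "(E has_field_derivative E' z) (at z)" for z
    unfolding E_def E'_def by (rule termdiffs_strong_converges_everywhere[OF summ])
  \<comment> \<open>This says that z^(1 - \<theta>) E(z) has derivative exp z / z^\<theta>, but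
    without any branch of the power, so it serves at z and at -u alike.\<close>
  have ode: "(1 - \<theta>) * E z + z * E' z = exp z" for z
  proof -
    have "(\<lambda>k. c k * z ^ k) sums E z" unfolding E_def by (rule summable_sums[OF summ])
    moreover have "(\<lambda>k. of_nat k * c k * z ^ (k - Suc 0)) sums E' z"
      unfolding E'_def by (intro diffs_equiv termdiff_converges_all summ)
    ultimately have "(\<lambda>k. (1 - \<theta>) * (c k * z ^ k) + z * (of_nat k * c k * z ^ (k - Suc 0))) sums ((1 - \<theta>) * E z + z * E' z)"
      by (intro sums_add sums_mult)
    also have "(\<lambda>k. (1 - \<theta>) * (c k * z ^ k) + z * (of_nat k * c k * z ^ (k - Suc 0))) = (\<lambda>k. z ^ k /\<^sub>R fact k)"
    proof
      fix k
      have "(1 - \<theta>) * (c k * z ^ k) + z * (of_nat k * c k * z ^ (k - Suc 0)) = (of_nat k + 1 - \<theta>) * c k * z ^ k"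
        by (cases k) (simp_all add: algebra_simps)
      also have "\<dots> = z ^ k /\<^sub>R fact k" using knz[of k] by (simp add: c_def scaleR_conv_of_real divide_inverse)
      finally show "(1 - \<theta>) * (c k * z ^ k) + z * (of_nat k * c k * z ^ (k - Suc 0)) = z ^ k /\<^sub>R fact k" .
    qed
    finally show ?thesis using exp_converges[of z] sums_unique2 by blast
  qed
  define \<Phi> where "\<Phi> = (\<lambda>z. z powr (1 - \<theta>) * E z)"
  have \<Phi>: "(\<Phi> has_field_derivative exp z / z powr \<theta>) (at z)" if "z \<notin> \<real>\<^sub>\<le>\<^sub>0" for z
  proof -
    have nz: "z \<noteq> 0" using that by auto
    have "(\<Phi> has_field_derivative ((1 - \<theta>) * z powr (1 - \<theta> - 1)) * E z + E' z * z powr (1 - \<theta>)) (at z)"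
      unfolding \<Phi>_def by (intro DERIV_mult has_field_derivative_powr that E)
    also have "((1 - \<theta>) * z powr (1 - \<theta> - 1)) * E z + E' z * z powr (1 - \<theta>) = ((1 - \<theta>) * E z + z * E' z) / z powr \<theta>"
      using nz by (simp add: powr_diff powr_minus field_simps)
    finally show ?thesis unfolding ode .
  qed
  define \<Psi> where "\<Psi> = (\<lambda>u. u powr (1 - \<theta>) * E (- u))"
  have \<Psi>: "(\<Psi> has_field_derivative exp (- u) / u powr \<theta>) (at u)" if "Re u > 0" for u
  proof -
    have nz: "u \<noteq> 0" "u \<notin> \<real>\<^sub>\<le>\<^sub>0" using that by (auto simp: complex_nonpos_Reals_iff)
    have "(\<Psi> has_field_derivative ((1 - \<theta>) * u powr (1 - \<theta> - 1)) * E (- u) + (E' (- u) * (- 1)) * u powr (1 - \<theta>)) (at u)"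
      unfolding \<Psi>_def
      by (intro DERIV_mult has_field_derivative_powr nz DERIV_chain2[where f = E and g = uminus] E DERIV_minus DERIV_ident)
    also have "((1 - \<theta>) * u powr (1 - \<theta> - 1)) * E (- u) + (E' (- u) * (- 1)) * u powr (1 - \<theta>)
        = ((1 - \<theta>) * E (- u) + (- u) * E' (- u)) / u powr \<theta>"
      using nz by (simp add: powr_diff powr_minus field_simps)
    finally show ?thesis unfolding ode .
  qed
  obtain L where real: "((\<lambda>x. \<Psi> (complex_of_real x)) \<longlongrightarrow> L) at_top" and L: "\<And>y. ((\<lambda>z. \<Psi> (- z)) \<longlongrightarrow> L) (strip_end y)"
    by (rule incomplete_Gamma_limit[of \<Psi> \<theta>]) (use \<Psi> \<theta> in auto)
  \<comment> \<open>On the positive axis \<Psi>(b) is the integral of t^(-\<theta>) exp(-t) over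
    [0, b], because \<Psi> vanishes at 0; letting b grow gives Euler's integral.\<close>
  have "L = Gamma (1 - \<theta>)"
  proof -
    define f where "f = (\<lambda>t. of_real t powr (1 - \<theta> - 1) / complex_of_real (exp t))"
    have re: "Re (1 - \<theta>) > 0" using \<theta> by simp
    \<comment> \<open>\<open>0 powr _ = 0\<close> by convention, so the half-line may be closed at 0
      without changing the integrand.\<close>
    have f0: "f 0 = 0" by (simp add: f_def)
    have "f absolutely_integrable_on {0<..}"
      unfolding f_def by (rule absolutely_integrable_Gamma_integral'[OF re])
    moreover have "(\<lambda>t. indicator {0<..} t *\<^sub>R f t) = (\<lambda>t. indicator {0..} t *\<^sub>R f t)"
      using f0 by (auto simp: fun_eq_iff indicator_def less_le)
    ultimately have abs: "f absolutely_integrable_on {0..}" by (simp add: set_integrable_def)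
    have "((\<lambda>b. set_lebesgue_integral lebesgue {0..b} f) \<longlongrightarrow> set_lebesgue_integral lebesgue {0..} f) at_top"
      by (rule tendsto_set_lebesgue_integral_at_top[OF _ abs]) auto
    also have "set_lebesgue_integral lebesgue {0..} f = Gamma (1 - \<theta>)"
      using Gamma_integral_complex[OF re] set_lebesgue_integral_eq_integral(2)[OF abs]
      by (simp add: f_def integral_unique)
    finally have lim: "((\<lambda>b. set_lebesgue_integral lebesgue {0..b} f) \<longlongrightarrow> Gamma (1 - \<theta>)) at_top" .
    have "\<forall>\<^sub>F b in at_top. set_lebesgue_integral lebesgue {0..b} f = \<Psi> (complex_of_real b)"
      using eventually_gt_at_top[of 0]
    proof eventually_elim
      fix b :: real assume b: "b > 0"
      have contE: "continuous_on S E" for S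
        using E by (intro continuous_at_imp_continuous_on ballI DERIV_isCont)
      have "(f has_integral (\<Psi> (complex_of_real b) - \<Psi> (complex_of_real 0))) {0..b}"
      proof (rule fundamental_theorem_of_calculus_interior)
        show "continuous_on {0..b} (\<lambda>t. \<Psi> (complex_of_real t))"
          unfolding \<Psi>_def using re
          by (intro continuous_intros continuous_on_compose2[OF contE[of UNIV]]) auto
        fix t assume t: "t \<in> {0<..<b}"
        have "((\<lambda>t. \<Psi> (complex_of_real t)) has_vector_derivative exp (- of_real t) / of_real t powr \<theta>) (at t)"
          by (rule has_vector_derivative_real_field[OF \<Psi>]) (use t in auto)
        also have "exp (- of_real t) / of_real t powr \<theta> = f t"
          using t by (simp add: f_def powr_minus exp_minus exp_of_real divide_inverse)
        finally show "((\<lambda>t. \<Psi> (complex_of_real t)) has_vector_derivative f t) (at t)" .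
      qed (use b in auto)
      then have "integral {0..b} f = \<Psi> (complex_of_real b)"
        by (simp add: integral_unique \<Psi>_def)
      moreover have "f absolutely_integrable_on {0..b}"
        by (rule set_integrable_subset[OF abs]) auto
      ultimately show "set_lebesgue_integral lebesgue {0..b} f = \<Psi> (complex_of_real b)"
        by (simp add: set_lebesgue_integral_eq_integral)
    qed
    from Lim_transform_eventually[OF lim this] show ?thesis
      using real tendsto_unique trivial_limit_at_top_linorder by blast
  qed
  \<comment> \<open>The phase of z^(1 - \<theta>) relative to (-z)^(1 - \<theta>): True for the
    upper side of the cut, False for the lower.\<close>
  define s where "s = (\<lambda>b::bool. exp ((1 - \<theta>) * (if b then \<i> * pi else - (\<i> * pi))))"
  have eq: "\<Phi> z = s (Im z > 0) * \<Psi> (- z)" if "Im z \<noteq> 0" for z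
  proof -
    have "z \<noteq> 0" using that by auto
    then show ?thesis
      using Ln_reflect[OF that] by (simp add: \<Phi>_def \<Psi>_def s_def powr_def exp_add[symmetric] algebra_simps)
  qed
  have up: "(\<Phi> \<longlongrightarrow> s True * L) (strip_end y)" if "y > 0" for y
    by (rule Lim_transform_eventually[OF tendsto_mult[OF tendsto_const L]])
       (use strip_end_upper[OF that] in \<open>eventually_elim, auto simp: eq\<close>)
  have low: "(\<Phi> \<longlongrightarrow> s False * L) (strip_end (- y))" if "y > 0" for y
    by (rule Lim_transform_eventually[OF tendsto_mult[OF tendsto_const L]])
       (use strip_end_lower[OF that] in \<open>eventually_elim, auto simp: eq\<close>)
  have "s True = exp (\<i> * (of_real pi * (1 - \<theta>)))" "s False = exp (- (\<i> * (of_real pi * (1 - \<theta>))))"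
    by (simp_all add: s_def algebra_simps)
  then have "s True - s False = 2 * \<i> * sin (of_real pi * (1 - \<theta>))"
    by (simp only: sin_exp_eq) simp
  also have "sin (of_real pi * (1 - \<theta>)) = sin (of_real pi * \<theta>)"
    by (simp add: right_diff_distrib sin_diff flip: sin_of_real cos_of_real)
  finally have s: "s True - s False = 2 * \<i> * sin (of_real pi * \<theta>)" .
  have "1 - \<theta> \<notin> \<int>\<^sub>\<le>\<^sub>0" using \<theta> by (auto elim!: nonpos_Ints_cases simp: complex_eq_iff)
  then have "rGamma (1 - \<theta>) \<noteq> 0" by (simp add: rGamma_eq_zero_iff)
  then have "sin (of_real pi * \<theta>) * Gamma (1 - \<theta>) = of_real pi * rGamma \<theta>"
    using rGamma_reflection_complex[of \<theta>] by (simp add: Gamma_def field_simps)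
  then have diff: "s True * L - s False * L = 2 * of_real pi * \<i> * rGamma \<theta>"
    using s \<open>L = _\<close> by (simp add: left_diff_distrib[symmetric] mult.assoc)
  have "hankel_primitive \<theta> \<Phi>"
    by (rule hankel_primitiveI[OF \<Phi> up low diff])
  then show ?thesis by blast
qed

text \<open>Integration by parts climbs through unit strips of Re \<theta>. The induction includes
  the edge Re \<theta> = 0, from which the points with Re \<theta> = 1 are reached, all but \<theta>
  = 1 itself: its predecessor is 0.\<close>

lemma hankel_primitive_exists:
  assumes "Re \<theta> > 0"
  shows "\<exists>\<Phi>. hankel_primitive \<theta> \<Phi>"
proof -
  have "\<theta> \<noteq> 0 \<Longrightarrow> 0 \<le> Re \<theta> \<Longrightarrow> Re \<theta> < real k + 1 \<Longrightarrow> \<exists>\<Phi>. hankel_primitive \<theta> \<Phi>" for k \<theta>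
  proof (induction k arbitrary: \<theta>)
    case 0
    then show ?case using hankel_primitive_base[of \<theta>] by simp
  next
    case (Suc k)
    consider "Re \<theta> < 1" | "\<theta> = 1" | "\<theta> \<noteq> 1" "Re \<theta> \<ge> 1" by linarith
    then show ?case
    proof cases
      case 3
      then obtain \<Phi> where "hankel_primitive (\<theta> - 1) \<Phi>" using Suc.IH[of "\<theta> - 1"] Suc.prems by auto
      from hankel_primitive_add1[OF this] 3 show ?thesis by auto
    qed (use Suc.prems hankel_primitive_base hankel_primitive_1 in auto)
  qed
  moreover obtain k where "Re \<theta> < real k" using reals_Archimedean2 by blast
  ultimately show ?thesis using assms by (metis add.commute add_strict_increasing less_eq_real_def less_irrefl zero_complex.sel(1) zero_less_one)
qed

text \<open>At index -1 the power of z disappears, and w = \<rho> (z - 1) turns the integrand into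
  Hankel's.\<close>

lemma special_G_minus1:
  assumes \<gamma>: "hankel_contour \<epsilon> \<gamma>" and \<rho>: "\<rho> > 0" and \<theta>: "Re \<theta> > 0"
  shows "special_G \<gamma> \<rho> \<theta> (- 1) = exp (of_real \<rho>) * of_real \<rho> powr (\<theta> - 1) * rGamma \<theta>"
proof -
  obtain \<Phi> where "hankel_primitive \<theta> \<Phi>" using hankel_primitive_exists[OF \<theta>] ..
  then obtain Lp Lm where \<Phi>: "\<And>w. w \<notin> \<real>\<^sub>\<le>\<^sub>0 \<Longrightarrow> (\<Phi> has_field_derivative exp w / w powr \<theta>) (at w)"
    and L: "\<And>y. y > 0 \<Longrightarrow> (\<Phi> \<longlongrightarrow> Lp) (strip_end y)" "\<And>y. y > 0 \<Longrightarrow> (\<Phi> \<longlongrightarrow> Lm) (strip_end (- y))"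
    and diff: "Lp - Lm = 2 * of_real pi * \<i> * rGamma \<theta>"
    by (auto simp: hankel_primitive_def)
  have \<epsilon>: "\<epsilon> > 0" using \<gamma> by (simp add: hankel_contour_def)
  \<comment> \<open>The shift by 1 contributes exp \<rho>, the scaling of the power \<rho>^\<theta>,
    and the scaling of dz one factor 1 / \<rho>.\<close>
  let ?c = "exp (complex_of_real \<rho>) * of_real \<rho> powr (\<theta> - 1)"
  let ?s = "\<lambda>z. complex_of_real \<rho> * (z - 1)"
  have s: "filterlim ?s (strip_end (\<rho> * y)) (strip_end y)" for y
  proof -
    have "filterlim (\<lambda>z. - 1 + Re z) at_bot (strip_end y)"
      using filterlim_tendsto_add_at_top[OF tendsto_const[of 1], of "\<lambda>z. - Re z" "strip_end y"] strip_end_Re[of y]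
      by (simp add: filterlim_uminus_at_top)
    from filterlim_tendsto_pos_mult_at_bot[OF tendsto_const \<rho> this]
    have "filterlim (\<lambda>z. \<rho> * (- 1 + Re z)) at_bot (strip_end y)" .
    then show ?thesis
      by (auto simp: filterlim_strip_end_iff intro!: tendsto_intros strip_end_Im)
  qed
  have "improper_contour_integral \<gamma> (\<lambda>z. exp (complex_of_real \<rho> * z) / (z powi (- 1 + 1) * (z - 1) powr \<theta>)) = ?c * Lp - ?c * Lm"
  proof (rule improper_contour_integral_primitive[OF \<gamma>, where \<Phi> = "\<lambda>z. ?c * \<Phi> (?s z)"])
    show "((\<lambda>z. ?c * \<Phi> (?s z)) \<longlongrightarrow> ?c * Lp) (strip_end \<epsilon>)"
      by (intro tendsto_mult tendsto_const filterlim_compose[OF L(1) s]) (use \<rho> \<epsilon> in auto)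
    have "((\<lambda>z. \<Phi> (?s z)) \<longlongrightarrow> Lm) (strip_end (- \<epsilon>))"
      by (rule filterlim_compose[OF L(2)[of "\<rho> * \<epsilon>"]]) (use \<rho> \<epsilon> s[of "- \<epsilon>"] in auto)
    then show "((\<lambda>z. ?c * \<Phi> (?s z)) \<longlongrightarrow> ?c * Lm) (strip_end (- \<epsilon>))"
      by (intro tendsto_mult tendsto_const)
    fix z :: complex assume z: "z - 1 \<notin> \<real>\<^sub>\<le>\<^sub>0"
    have sz: "?s z \<notin> \<real>\<^sub>\<le>\<^sub>0"
      using z \<rho> by (auto simp: complex_nonpos_Reals_iff mult_le_0_iff)
    have "((\<lambda>z. \<Phi> (?s z)) has_field_derivative exp (?s z) / ?s z powr \<theta> * of_real \<rho>) (at z)"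
      by (rule DERIV_chain2[where f = \<Phi> and g = ?s, OF \<Phi>[OF sz]]) (auto intro!: derivative_eq_intros)
    then have "((\<lambda>z. ?c * \<Phi> (?s z)) has_field_derivative ?c * (exp (?s z) / ?s z powr \<theta> * of_real \<rho>)) (at z)"
      by (rule DERIV_cmult)
    also have "?c * (exp (?s z) / ?s z powr \<theta> * of_real \<rho>) = exp (of_real \<rho> * z) / (z powi (- 1 + 1) * (z - 1) powr \<theta>)"
    proof -
      have "exp (of_real \<rho> * z) = exp (of_real \<rho>) * exp (?s z)" by (simp add: exp_add[symmetric] algebra_simps)
      moreover have "?s z powr \<theta> = of_real \<rho> powr \<theta> * (z - 1) powr \<theta>"
        using \<rho> by (intro powr_times_real_left) auto
      moreover have "of_real \<rho> powr (\<theta> - 1) * of_real \<rho> = (of_real \<rho> powr \<theta> :: complex)" "of_real \<rho> powr \<theta> \<noteq> (0::complex)"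
        using \<rho> by (auto simp: powr_diff)
      moreover have "a * b * (e / (p * q) * r) = a * e / (1 * q)" if "b * r = p" "p \<noteq> 0" for a b e p q r :: complex
        using that by (auto simp: field_simps)
      ultimately show ?thesis by simp
    qed
    finally show "((\<lambda>z. ?c * \<Phi> (?s z)) has_field_derivative exp (of_real \<rho> * z) / (z powi (- 1 + 1) * (z - 1) powr \<theta>)) (at z)" .
  qed
  then have "special_G \<gamma> \<rho> \<theta> (- 1) = 1 / (2 * of_real pi * \<i>) * (?c * (Lp - Lm))"
    by (simp add: special_G_def right_diff_distrib)
  moreover have "1 / k * (c * (k * x)) = c * x" if "k \<noteq> 0" for k c x :: complex
    using that by simp
  ultimately show ?thesis unfolding diff by (metis complex_i_not_zero mult_eq_0_iff of_real_eq_0_iff pi_neq_zero zero_neq_numeral)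
qed

section \<open>The functions F\<close>

lemma circle_off_cut:
  assumes "0 < r" "r < 1" "z \<in> path_image (circlepath 0 r)"
  shows "z \<noteq> 0" "- 1 * (z - 1) \<notin> \<real>\<^sub>\<le>\<^sub>0"
proof -
  have "norm z = r" using assms by (simp add: dist_norm)
  then show "z \<noteq> 0" "- 1 * (z - 1) \<notin> \<real>\<^sub>\<le>\<^sub>0"
    using assms complex_Re_le_cmod[of z] by (auto simp: complex_nonpos_Reals_iff)
qed

lemma special_F_nat:
  "special_F r \<rho> \<theta> (int k - 1) = 1 / (2 * complex_of_real pi * \<i>) *
     contour_integral (circlepath 0 r) (\<lambda>z. exp (complex_of_real \<rho> * z) / (z ^ k * (- 1 * (z - 1)) powr \<theta>))"
  by (simp add: special_F_def)

text \<open>The same exact derivative, now with sign -1, integrates to 0 because the circle is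
  closed and avoids both 0 and the cut to the right of 1.\<close>

lemma special_F_recurrence:
  assumes r: "0 < r" "r < 1"
  shows "(of_nat n + 1) * special_F r \<rho> \<theta> (int n + 1) =
    (of_real \<rho> + of_nat n + \<theta>) * special_F r \<rho> \<theta> (int n) - of_real \<rho> * special_F r \<rho> \<theta> (int n - 1)"
proof -
  let ?c = "circlepath 0 r"
  define g where "g = (\<lambda>k z. exp (complex_of_real \<rho> * z) / (z ^ k * (- 1 * (z - 1)) powr \<theta>))"
  define I where "I = (\<lambda>k. contour_integral ?c (g k))"
  note off = circle_off_cut[OF r]
  have I: "(g k has_contour_integral I k) ?c" for k
    unfolding I_def
  proof (rule has_contour_integral_integral, rule contour_integrable_continuous_circlepath)
    have "isCont (g k) z" if "z \<in> path_image ?c" for z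
      unfolding g_def using off[OF that]
      by (intro continuous_intros) auto
    then show "continuous_on (path_image ?c) (g k)" by (intro continuous_at_imp_continuous_on) auto
  qed
  let ?h = "\<lambda>z. of_real \<rho> * g n z + (of_nat n + 1) * g (Suc (Suc n)) z - (of_real \<rho> + of_nat n + \<theta>) * g (Suc n) z"
  have "(?h has_contour_integral of_real \<rho> * I n + (of_nat n + 1) * I (Suc (Suc n)) - (of_real \<rho> + of_nat n + \<theta>) * I (Suc n)) ?c"
    by (intro has_contour_integral_diff has_contour_integral_add has_contour_integral_lmul I)
  moreover have "(?h has_contour_integral
      ((\<lambda>z. (z - 1) * g (Suc n) z) (pathfinish ?c) - (\<lambda>z. (z - 1) * g (Suc n) z) (pathstart ?c))) ?c"
  proof (rule contour_integral_primitive[where S = "path_image ?c"])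
    show "((\<lambda>z. (z - 1) * g (Suc n) z) has_field_derivative ?h z) (at z within path_image ?c)" if "z \<in> path_image ?c" for z
      unfolding g_def by (rule has_field_derivative_at_within[OF kernel_antiderivative[OF off[OF that]]])
  qed auto
  then have "(?h has_contour_integral 0) ?c" by simp
  ultimately have rel: "of_real \<rho> * I n + (of_nat n + 1) * I (Suc (Suc n)) - (of_real \<rho> + of_nat n + \<theta>) * I (Suc n) = 0"
    by (rule has_contour_integral_unique)
  define c where "c = 1 / (2 * complex_of_real pi * \<i>)"
  have F: "special_F r \<rho> \<theta> (int k - 1) = c * I k" for k
    by (simp only: special_F_nat I_def g_def c_def)
  have "special_F r \<rho> \<theta> (int n - 1) = c * I n"
    "special_F r \<rho> \<theta> (int n) = c * I (Suc n)"
    "special_F r \<rho> \<theta> (int n + 1) = c * I (Suc (Suc n))"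
    using F[of n] F[of "Suc n"] F[of "Suc (Suc n)"] by (simp_all add: add.commute)
  with rel show ?thesis by algebra
qed

text \<open>The integrand is holomorphic in the disc for index -1 and has residue 1 at 0 for index
  0. The vanishing of F_(-1) is what makes F compatible with the boundary equation at the empty
  queue.\<close>

lemma special_F_initial:
  assumes r: "0 < r" "r < 1"
  shows "special_F r \<rho> \<theta> (- 1) = 0" "special_F r \<rho> \<theta> 0 = 1"
proof -
  let ?f = "\<lambda>z. exp (complex_of_real \<rho> * z) / (1 - z) powr \<theta>"
  have cut: "1 - z \<notin> \<real>\<^sub>\<le>\<^sub>0" if "norm z < 1" for z :: complex
    using complex_Re_le_cmod[of z] that by (auto simp: complex_nonpos_Reals_iff)
  have hol: "?f holomorphic_on ball 0 1"
    by (intro holomorphic_intros) (use cut in force)+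
  have "(?f has_contour_integral 0) (circlepath 0 r)"
    by (rule Cauchy_theorem_disc_simple[OF hol]) (use r in \<open>auto simp: dist_norm\<close>)
  then show "special_F r \<rho> \<theta> (- 1) = 0"
    by (simp add: special_F_def contour_integral_unique)
  have "?f holomorphic_on cball 0 r"
    by (rule holomorphic_on_subset[OF hol]) (use r in auto)
  from Cauchy_integral_circlepath_simple[OF this, of 0]
  have "((\<lambda>z. ?f z / z) has_contour_integral 2 * of_real pi * \<i>) (circlepath 0 r)" using r by simp
  moreover have "(\<lambda>z. ?f z / z) = (\<lambda>z. exp (complex_of_real \<rho> * z) / (z powi (0 + 1) * (1 - z) powr \<theta>))"
    by (simp add: fun_eq_iff mult.commute)
  ultimately show "special_F r \<rho> \<theta> 0 = 1"
    by (simp add: special_F_def contour_integral_unique)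
qed

section \<open>The Green function of the backward equations\<close>

text \<open>At i = 0 the truncated \<open>i - 1\<close> is 0, but its coefficient
  \<open>min i m\<close> is 0 as well, so the boundary equation has no separate case. The parameter
  d is the source.\<close>

definition backward_at :: "nat \<Rightarrow> real \<Rightarrow> complex \<Rightarrow> complex \<Rightarrow> (nat \<Rightarrow> complex) \<Rightarrow> nat \<Rightarrow> bool" where
  "backward_at m \<rho> \<theta> d x i \<longleftrightarrow>
     (of_real \<rho> + of_nat (min i m) + \<theta>) * x i = d + of_real \<rho> * x (Suc i) + of_nat (min i m) * x (i - 1)"

text \<open>A maximum principle: |x_i| is at most a weighted sum of its neighbours with total weight
  at most q < 1, so the supremum s satisfies s \<le> q s.\<close>

lemma backward_unique:
  assumes "\<rho> > 0" "Re \<theta> > 0" and eq: "\<And>i. backward_at m \<rho> \<theta> 0 x i" and "bounded (range x)"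
  shows "x i = 0"
proof -
  have bdd: "bdd_above (range (\<lambda>i. norm (x i)))"
    using \<open>bounded (range x)\<close> by (auto simp: bounded_iff bdd_above_def)
  define s where "s = (SUP i. norm (x i))"
  have le: "norm (x i) \<le> s" for i
    unfolding s_def by (rule cSUP_upper[OF _ bdd]) simp
  have s0: "s \<ge> 0" using le[of 0] norm_ge_zero order_trans by blast
  \<comment> \<open>The weight (\<rho> + k) / (\<rho> + k + Re \<theta>) increases with the death
    rate k, and k is at most m.\<close>
  define q where "q = (\<rho> + real m) / (\<rho> + real m + Re \<theta>)"
  have q: "q < 1" using assms by (simp add: q_def)
  have "norm (x i) \<le> q * s" for i
  proof -
    define k where "k = real (min i m)"
    have k: "0 \<le> k" "k \<le> real m" by (auto simp: k_def)
    have "(\<rho> + k + Re \<theta>) * norm (x i) \<le> norm (of_real \<rho> + of_nat (min i m) + \<theta>) * norm (x i)"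
      using complex_Re_le_cmod[of "of_real \<rho> + of_nat (min i m) + \<theta>"] by (intro mult_right_mono) (auto simp: k_def)
    also have "\<dots> = norm (of_real \<rho> * x (Suc i) + of_nat (min i m) * x (i - 1))"
      using eq[of i] by (simp add: backward_at_def flip: norm_mult)
    also have "\<dots> \<le> norm (of_real \<rho> * x (Suc i)) + norm (of_nat (min i m) * x (i - 1))" by (rule norm_triangle_ineq)
    also have "\<dots> = \<rho> * norm (x (Suc i)) + k * norm (x (i - 1))"
      using assms by (simp add: norm_mult k_def)
    also have "\<dots> \<le> \<rho> * s + k * s" using assms k by (intro add_mono mult_left_mono le) auto
    finally have "norm (x i) \<le> (\<rho> + k) / (\<rho> + k + Re \<theta>) * s"
      using assms k by (simp add: field_simps)
    also have "\<dots> \<le> q * s"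
      unfolding q_def using assms k s0 by (intro mult_right_mono) (auto simp: field_simps)
    finally show ?thesis .
  qed
  then have "s \<le> q * s" unfolding s_def by (intro cSUP_least) auto
  then have "(1 - q) * s \<le> 0" by (simp add: algebra_simps)
  then have "s \<le> 0" using q by (simp add: mult_le_0_iff)
  with le[of i] show ?thesis by (metis norm_le_zero_iff order_trans)
qed

text \<open>Agreement at two states is what gluing takes: the equation at m belongs to the lower
  piece but reads the value at m + 1, and the equation at m + 1 belongs to the upper piece but reads
  the value at m.\<close>

lemma backward_patch:
  assumes "i \<le> m \<Longrightarrow> (of_real \<rho> + of_nat i + \<theta>) * l i = of_real \<rho> * l (Suc i) + of_nat i * l (i - 1)"
    and "i > m \<Longrightarrow> (of_real \<rho> + of_nat m + \<theta>) * u i = of_real \<rho> * u (Suc i) + of_nat m * u (i - 1)"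
    and "l m = u m" "l (Suc m) = u (Suc m)"
  shows "backward_at m \<rho> \<theta> 0 (\<lambda>i. if i \<le> m then l i else u i) i"
proof (cases "i \<le> m")
  case True
  then show ?thesis
    using assms(1,4) by (cases "i = m") (auto simp: backward_at_def)
next
  case False
  then show ?thesis
    using assms(2,3) by (cases "i = Suc m") (auto simp: backward_at_def)
qed

text \<open>The recurrence of F and G is the forward equation of the queue below m. Dividing by the
  reversible measure, here \<rho>^i / i!, turns forward into backward solutions.\<close>

lemma backward_lower:
  fixes x :: "nat \<Rightarrow> complex"
  assumes "\<rho> > 0" "i > 0"
    and "(of_nat i + 1) * x (Suc i) = (of_real \<rho> + of_nat i + \<theta>) * x i - of_real \<rho> * x (i - 1)"
  defines "l \<equiv> \<lambda>i. fact i / of_real \<rho> ^ i * x i"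
  shows "(of_real \<rho> + of_nat i + \<theta>) * l i = of_real \<rho> * l (Suc i) + of_nat i * l (i - 1)"
proof -
  obtain j where j: "i = Suc j" using assms(2) gr0_implies_Suc by auto
  have "of_real \<rho> * l (Suc i) = fact i / of_real \<rho> ^ i * ((of_nat i + 1) * x (Suc i))"
    using assms(1) by (simp add: l_def field_simps)
  moreover have "of_nat i * l (i - 1) = fact i / of_real \<rho> ^ i * (of_real \<rho> * x (i - 1))"
    using assms(1) by (simp add: l_def j field_simps)
  ultimately have "of_real \<rho> * l (Suc i) + of_nat i * l (i - 1)
      = fact i / of_real \<rho> ^ i * ((of_nat i + 1) * x (Suc i) + of_real \<rho> * x (i - 1))"
    by (simp only: distrib_left)
  also have "(of_nat i + 1) * x (Suc i) + of_real \<rho> * x (i - 1) = (of_real \<rho> + of_nat i + \<theta>) * x i"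
    using assms(3) by simp
  finally show ?thesis by (simp add: l_def)
qed

lemma recurrence_scale:
  fixes r s t k k' x x' y y' z z' :: complex
  assumes "s * x = r * y + t * z" "s * x' = r * y' + t * z'"
  shows "s * (k * x) = r * (k * y) + t * (k * z)"
    and "s * (k * (x * e - x' * h)) = r * (k * (y * e - y' * h)) + t * (k * (z * e - z' * h))"
  using assms by algebra+

text \<open>Above m the coefficients are constant, so powers of a root of the characteristic
  quadratic solve the equation. The strict i > m keeps \<open>i - 1 - m\<close> from being
  truncated.\<close>

lemma backward_upper:
  fixes y :: complex
  assumes "i > m" "of_real \<rho> * y\<^sup>2 + of_nat m = (of_real \<rho> + of_nat m + \<theta>) * y"
  shows "(of_real \<rho> + of_nat m + \<theta>) * y ^ (i - m) = of_real \<rho> * y ^ (Suc i - m) + of_nat m * y ^ (i - 1 - m)"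
proof -
  obtain j where j: "i = Suc (m + j)" using assms(1) less_imp_Suc_add by auto
  have "(of_real \<rho> + of_nat m + \<theta>) * y ^ (i - m) = ((of_real \<rho> + of_nat m + \<theta>) * y) * y ^ j"
    by (simp add: j)
  also have "\<dots> = of_real \<rho> * y ^ (Suc i - m) + of_nat m * y ^ (i - 1 - m)"
    unfolding assms(2)[symmetric] by (simp add: j algebra_simps power2_eq_square Suc_diff_le)
  finally show ?thesis .
qed

text \<open>Abstracts from the contour integrals: F and G enter through their recurrences, the
  initial values of F and the Casoratian at 0, whose reciprocal is c.\<close>

locale mm_m_resolvent =
  fixes m :: nat and \<rho> :: real and \<theta> A B D c :: complex and f g :: "nat \<Rightarrow> complex"
  assumes m: "m \<ge> 1" and \<rho>: "\<rho> > 0" and \<theta>: "Re \<theta> > 0"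
    and f0: "f 0 = 1" and f1: "f 1 = of_real \<rho> + \<theta>"
    and f_rec: "\<And>n. n > 0 \<Longrightarrow> (of_nat n + 1) * f (Suc n) = (of_real \<rho> + of_nat n + \<theta>) * f n - of_real \<rho> * f (n - 1)"
    and g_rec: "\<And>n. n > 0 \<Longrightarrow> (of_nat n + 1) * g (Suc n) = (of_real \<rho> + of_nat n + \<theta>) * g n - of_real \<rho> * g (n - 1)"
    and casorati0: "c * (f 1 * g 0 - g 1 * f 0) = 1"
    and AB_sum: "of_nat m * (A + B) = of_nat m + of_real \<rho> + \<theta>" and AB_prod: "of_nat m * (A * B) = of_real \<rho>"
    and D: "D = of_nat m * (B - A)" "D \<noteq> 0" and B: "norm B \<ge> 1"
begin

text \<open>Since A B = \<rho> / m, these are 1 / B and 1 / A. The roots A and B govern the target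
  state n (forward equation), their reciprocals the starting state.\<close>

definition "a = of_nat m * A / of_real \<rho>"
definition "b = of_nat m * B / of_real \<rho>"
text \<open>Up to a common factor, E and -H are the coefficients of the powers of b and a in the
  continuation of f above m.\<close>

definition "E = (of_nat m + 1) * f (Suc m) - A * of_nat m * f m"
definition "H = (of_nat m + 1) * f (Suc m) - B * of_nat m * f m"
text \<open>Chosen so that the coefficient of the powers of b vanishes for g + \<kappa> f, leaving
  only the bounded powers of a.\<close>

definition "\<kappa> = (of_nat m * A * g m - (of_nat m + 1) * g (Suc m)) / E"

lemma nz: "of_nat m \<noteq> (0::complex)" "of_real \<rho> \<noteq> (0::complex)" "of_real \<rho> ^ k \<noteq> (0::complex)"
  using m \<rho> by auto

lemma aB: "a * B = 1" and bA: "A * b = 1"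
  and a_A: "of_real \<rho> / of_nat m * a = A" and b_B: "of_real \<rho> / of_nat m * b = B"
  using AB_prod nz by (simp_all add: a_def b_def field_simps)

lemma inverse_B: "inverse B = a"
  using aB by (metis inverse_unique mult.commute)

lemma norm_a: "norm a \<le> 1"
  unfolding inverse_B[symmetric] norm_inverse using B by (rule inverse_le_1_iff[THEN iffD2, OF disjI2])

lemma quadratic: "of_real \<rho> * a\<^sup>2 + of_nat m = (of_real \<rho> + of_nat m + \<theta>) * a"
  "of_real \<rho> * b\<^sup>2 + of_nat m = (of_real \<rho> + of_nat m + \<theta>) * b"
proof -
  have s: "of_real \<rho> * (a + b) = of_real \<rho> + of_nat m + \<theta>"
    using AB_sum nz by (simp add: a_def b_def field_simps)
  have p: "of_real \<rho> * (a * b) = of_nat m"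
    using AB_prod nz by (simp add: a_def b_def field_simps)
  show "of_real \<rho> * a\<^sup>2 + of_nat m = (of_real \<rho> + of_nat m + \<theta>) * a"
    "of_real \<rho> * b\<^sup>2 + of_nat m = (of_real \<rho> + of_nat m + \<theta>) * b"
    using s p by algebra+
qed

lemma lower_f: "(of_real \<rho> + of_nat i + \<theta>) * (fact i / of_real \<rho> ^ i * f i) =
    of_real \<rho> * (fact (Suc i) / of_real \<rho> ^ Suc i * f (Suc i)) + of_nat i * (fact (i - 1) / of_real \<rho> ^ (i - 1) * f (i - 1))"
proof (cases "i = 0")
  case True
  then show ?thesis using f0 f1 nz by simp
next
  case False
  then show ?thesis using backward_lower[OF \<rho> _ f_rec] by blast
qed

text \<open>If \<open>E\<close> vanished, the solution \<open>i! F_i / \<rho>^i\<close> would continue beyond \<open>m\<close> as a multiple of the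
  bounded solution \<open>B^(m-i)\<close>, contradicting uniqueness.\<close>

lemma E_nz: "E \<noteq> 0"
proof
  assume E0: "E = 0"
  define l where "l = (\<lambda>i. fact i / of_real \<rho> ^ i * f i)"
  define v where "v = (\<lambda>i. if i \<le> m then l i else l m * a ^ (i - m))"
  have "backward_at m \<rho> \<theta> 0 v i" for i
    unfolding v_def
  proof (rule backward_patch)
    show "(of_real \<rho> + of_nat i + \<theta>) * l i = of_real \<rho> * l (Suc i) + of_nat i * l (i - 1)"
      unfolding l_def by (rule lower_f)
    show "(of_real \<rho> + of_nat m + \<theta>) * (l m * a ^ (i - m)) = of_real \<rho> * (l m * a ^ (Suc i - m)) + of_nat m * (l m * a ^ (i - 1 - m))"
      if "i > m"
      by (rule recurrence_scale(1)[OF backward_upper[OF that quadratic(1)] backward_upper[OF that quadratic(1)]])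
    have "(of_nat m + 1) * f (Suc m) = A * of_nat m * f m" using E0 by (simp add: E_def)
    moreover have "l (Suc m) = fact m / of_real \<rho> ^ m / of_real \<rho> * ((of_nat m + 1) * f (Suc m))"
      using nz by (simp add: l_def field_simps)
    ultimately show "l (Suc m) = l m * a ^ (Suc m - m)" using nz by (simp add: l_def a_def)
  qed simp
  moreover have "bounded (range v)"
  proof -
    have "norm (v i) \<le> (\<Sum>k\<le>m. norm (l k))" for i
    proof -
      have lm: "norm (l k) \<le> (\<Sum>k\<le>m. norm (l k))" if "k \<le> m" for k
        using that by (intro member_le_sum) auto
      have "norm (l m * a ^ k) \<le> norm (l m)" for k
        using norm_a by (simp add: norm_mult norm_power mult_left_le power_le_one)
      from order_trans[OF this lm[OF order_refl]] lm[of i] show ?thesis by (auto simp: v_def)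
    qed
    then show ?thesis by (auto simp: bounded_iff)
  qed
  ultimately have "v 0 = 0" by (rule backward_unique[OF \<rho> \<theta>])
  then show False using f0 by (simp add: v_def l_def)
qed

definition "\<phi> i = (if i \<le> m then fact i / of_real \<rho> ^ i * f i
   else fact m / of_real \<rho> ^ m / D * (b ^ (i - m) * E - a ^ (i - m) * H))"
definition "\<psi> i = (if i \<le> m then fact i / of_real \<rho> ^ i * (c * (g i + \<kappa> * f i)) else a ^ (i - m) / E)"
text \<open>The reversible measure, left unnormalised, so that no stability condition \<rho> < m
  enters.\<close>

definition \<pi> :: "nat \<Rightarrow> complex" where "\<pi> i = (if i \<le> m then of_real \<rho> ^ i / fact i else of_real \<rho> ^ m / fact m * (of_real \<rho> / of_nat m) ^ (i - m))"

text \<open>By the common recurrence each step multiplies the Casoratian by \<rho> / (i + 2), which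
  the prefactors cancel; c sets the constant to 1.\<close>

lemma casorati: "fact i / of_real \<rho> ^ i * (c * ((of_nat i + 1) * (f (Suc i) * g i - g (Suc i) * f i))) = 1"
proof (induction i)
  case 0
  then show ?case using casorati0 by simp
next
  case (Suc i)
  have "(of_nat (Suc i) + 1) * (f (Suc (Suc i)) * g (Suc i) - g (Suc (Suc i)) * f (Suc i))
     = of_real \<rho> * (f (Suc i) * g i - g (Suc i) * f i)"
    using f_rec[of "Suc i"] g_rec[of "Suc i"] by simp algebra
  moreover have "fact (Suc i) / of_real \<rho> ^ Suc i * (c * (of_real \<rho> * w)) = fact i / of_real \<rho> ^ i * (c * ((of_nat i + 1) * w))" for w
    using nz by (simp add: field_simps)
  ultimately show ?case using Suc by simp
qed

text \<open>E - H = D f_m and \<rho> (b E - a H) = D (m + 1) f_(m+1): the two coefficients above m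
  solve this linear system. Unreduced exponents such as \<open>m - m\<close> fit the premises of
  \<open>backward_patch\<close> literally.\<close>

lemma \<phi>_join: "fact m / of_real \<rho> ^ m * f m = fact m / of_real \<rho> ^ m / D * (b ^ (m - m) * E - a ^ (m - m) * H)"
  "fact (Suc m) / of_real \<rho> ^ Suc m * f (Suc m) = fact m / of_real \<rho> ^ m / D * (b ^ (Suc m - m) * E - a ^ (Suc m - m) * H)"
proof -
  have "E - H = D * f m" by (simp add: E_def H_def D algebra_simps)
  then show "fact m / of_real \<rho> ^ m * f m = fact m / of_real \<rho> ^ m / D * (b ^ (m - m) * E - a ^ (m - m) * H)"
    using D(2) by simp
  have "of_real \<rho> * (b * E - a * H) = D * ((of_nat m + 1) * f (Suc m))"
    using nz by (simp add: E_def H_def D a_def b_def algebra_simps)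
  then have eq: "b ^ (Suc m - m) * E - a ^ (Suc m - m) * H = D * ((of_nat m + 1) * f (Suc m)) / of_real \<rho>"
    using nz by (simp add: eq_divide_eq mult.commute)
  show "fact (Suc m) / of_real \<rho> ^ Suc m * f (Suc m) = fact m / of_real \<rho> ^ m / D * (b ^ (Suc m - m) * E - a ^ (Suc m - m) * H)"
    unfolding eq using D(2) nz by (simp add: field_simps)
qed

text \<open>Multiplied by E, the value g + \<kappa> f at m becomes m + 1 times the Casoratian, hence
  the normalisation 1 / E; at m + 1 the factor m A appears instead, which accounts for a.\<close>

lemma \<psi>_join: "fact m / of_real \<rho> ^ m * (c * (g m + \<kappa> * f m)) = a ^ (m - m) / E"
  "fact (Suc m) / of_real \<rho> ^ Suc m * (c * (g (Suc m) + \<kappa> * f (Suc m))) = a ^ (Suc m - m) / E"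
proof -
  have \<kappa>: "\<kappa> * E = of_nat m * A * g m - (of_nat m + 1) * g (Suc m)" using E_nz by (simp add: \<kappa>_def)
  have cas: "fact m / of_real \<rho> ^ m * (c * ((of_nat m + 1) * (f (Suc m) * g m - g (Suc m) * f m))) = 1"
    by (rule casorati)
  have "(g m + \<kappa> * f m) * E = (of_nat m + 1) * (f (Suc m) * g m - g (Suc m) * f m)"
    using \<kappa> E_def by algebra
  then have "fact m / of_real \<rho> ^ m * (c * (g m + \<kappa> * f m)) * E = 1" using cas by algebra
  then show "fact m / of_real \<rho> ^ m * (c * (g m + \<kappa> * f m)) = a ^ (m - m) / E"
    using E_nz by (simp add: eq_divide_eq)
  have "(g (Suc m) + \<kappa> * f (Suc m)) * E = of_nat m * A * (f (Suc m) * g m - g (Suc m) * f m)"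
    using \<kappa> E_def by algebra
  then have "fact m / of_real \<rho> ^ m * (c * ((of_nat m + 1) * (g (Suc m) + \<kappa> * f (Suc m)))) * E = of_nat m * A"
    using cas by algebra
  moreover have "fact (Suc m) / of_real \<rho> ^ Suc m * (c * (g (Suc m) + \<kappa> * f (Suc m)))
     = fact m / of_real \<rho> ^ m * (c * ((of_nat m + 1) * (g (Suc m) + \<kappa> * f (Suc m)))) / of_real \<rho>"
    using nz by (simp add: field_simps)
  ultimately show "fact (Suc m) / of_real \<rho> ^ Suc m * (c * (g (Suc m) + \<kappa> * f (Suc m))) = a ^ (Suc m - m) / E"
    using E_nz nz by (simp add: eq_divide_eq a_def field_simps)
qed

lemma \<phi>_backward: "backward_at m \<rho> \<theta> 0 \<phi> i"
  unfolding \<phi>_def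
proof (rule backward_patch[OF lower_f _ \<phi>_join])
  assume i: "i > m"
  show "(of_real \<rho> + of_nat m + \<theta>) * (fact m / of_real \<rho> ^ m / D * (b ^ (i - m) * E - a ^ (i - m) * H)) =
    of_real \<rho> * (fact m / of_real \<rho> ^ m / D * (b ^ (Suc i - m) * E - a ^ (Suc i - m) * H)) +
    of_nat m * (fact m / of_real \<rho> ^ m / D * (b ^ (i - 1 - m) * E - a ^ (i - 1 - m) * H))"
    by (rule recurrence_scale(2)[OF backward_upper[OF i quadratic(2)] backward_upper[OF i quadratic(1)]])
qed

text \<open>State 0 has to be left out: a bounded solution at all states would be 0 by uniqueness,
  while \<psi> at m is 1 / E. The Green function uses this equation only at states beyond its
  target.\<close>

lemma \<psi>_backward: "i > 0 \<Longrightarrow> backward_at m \<rho> \<theta> 0 \<psi> i"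
  unfolding \<psi>_def
proof (rule backward_patch[OF _ _ \<psi>_join])
  assume i: "i > m"
  show "(of_real \<rho> + of_nat m + \<theta>) * (a ^ (i - m) / E) =
    of_real \<rho> * (a ^ (Suc i - m) / E) + of_nat m * (a ^ (i - 1 - m) / E)"
    using backward_upper[OF i quadratic(1)] by (simp add: add_divide_distrib[symmetric])
next
  assume i: "i > 0"
  show "(of_real \<rho> + of_nat i + \<theta>) * (fact i / of_real \<rho> ^ i * (c * (g i + \<kappa> * f i))) =
    of_real \<rho> * (fact (Suc i) / of_real \<rho> ^ Suc i * (c * (g (Suc i) + \<kappa> * f (Suc i)))) +
    of_nat i * (fact (i - 1) / of_real \<rho> ^ (i - 1) * (c * (g (i - 1) + \<kappa> * f (i - 1))))"
  proof (rule backward_lower[OF \<rho> i, where x = "\<lambda>i. c * (g i + \<kappa> * f i)"])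
    show "(of_nat i + 1) * (c * (g (Suc i) + \<kappa> * f (Suc i))) =
      (of_real \<rho> + of_nat i + \<theta>) * (c * (g i + \<kappa> * f i)) - of_real \<rho> * (c * (g (i - 1) + \<kappa> * f (i - 1)))"
      using f_rec[OF i] g_rec[OF i] by algebra
  qed
qed

lemma \<pi>_Suc: "of_nat (min (Suc i) m) * \<pi> (Suc i) = of_real \<rho> * \<pi> i"
proof (cases "i < m")
  case True
  have "of_nat (Suc i) \<noteq> (0::complex)" by (rule of_nat_neq_0)
  then show ?thesis using True nz by (simp add: \<pi>_def field_simps del: of_nat_Suc)
next
  case False
  then have "Suc i - m = Suc (i - m)" by simp
  then show ?thesis using False nz by (cases "i = m") (auto simp: \<pi>_def)
qed

text \<open>A step multiplies the Casoratian of \<phi> and \<psi> by the ratio of death rate to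
  \<rho>, and detailed balance (\<open>\<pi>_Suc\<close>) compensates this. The value 1 is the jump
  that creates the unit source.\<close>

lemma wronskian: "of_real \<rho> * \<pi> i * (\<phi> (Suc i) * \<psi> i - \<phi> i * \<psi> (Suc i)) = 1"
proof (induction i)
  case 0
  have "of_real \<rho> * (\<phi> (Suc 0) * \<psi> 0 - \<phi> 0 * \<psi> (Suc 0)) = c * (f 1 * g 0 - g 1 * f 0)"
    using m nz by (simp add: \<phi>_def \<psi>_def field_simps)
  then show ?case using casorati0 by (simp add: \<pi>_def mult.commute)
next
  case (Suc i)
  have "of_real \<rho> * \<pi> (Suc i) * (\<phi> (Suc (Suc i)) * \<psi> (Suc i) - \<phi> (Suc i) * \<psi> (Suc (Suc i)))
     = (of_nat (min (Suc i) m) * \<pi> (Suc i)) * (\<phi> (Suc i) * \<psi> i - \<phi> i * \<psi> (Suc i))"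
    using \<phi>_backward[of "Suc i"] \<psi>_backward[of "Suc i"] unfolding backward_at_def by simp algebra
  then show ?case using Suc by (simp add: \<pi>_Suc)
qed

definition "green i n = \<pi> n * \<phi> (min i n) * \<psi> (max i n)"

lemma green_backward: "backward_at m \<rho> \<theta> (if i = n then 1 else 0) (\<lambda>i. green i n) i"
proof -
  consider "i < n" | "i = n" | "i > n" by linarith
  then show ?thesis
  proof cases
    case 1
    then have "min (i - 1) n = i - 1" "max (i - 1) n = n" by auto
    with 1 show ?thesis
      using \<phi>_backward[of i] by (simp add: backward_at_def green_def) algebra
  next
    case 3
    then have "min (i - 1) n = n" "max (i - 1) n = i - 1" by auto
    with 3 show ?thesis
      using \<psi>_backward[of i] by (simp add: backward_at_def green_def) algebra
  next
    case 2
    \<comment> \<open>On the diagonal, \<psi> n times the equation of \<phi> contains \<phi> (Suc n)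
      \<psi> n, where the Green function has \<phi> n \<psi> (Suc n); \<open>wronskian\<close>
      measures the difference as 1.\<close>
    have "(of_real \<rho> + of_nat (min n m) + \<theta>) * (\<pi> n * \<phi> n * \<psi> n)
        = 1 + of_real \<rho> * (\<pi> n * \<phi> n * \<psi> (Suc n)) + of_nat (min n m) * (\<pi> n * \<phi> (n - 1) * \<psi> n)"
      using \<phi>_backward[of n, unfolded backward_at_def] wronskian[of n] by algebra
    moreover have "min (n - 1) n = n - 1" "max (n - 1) n = n" by auto
    ultimately show ?thesis using 2 by (simp add: backward_at_def green_def)
  qed
qed

text \<open>Beyond both n and m the function is a constant times powers of a, and |a| is at most 1;
  only finitely many states remain.\<close>

lemma green_bounded: "bounded (range (\<lambda>i. green i n))"
proof -
  define k where "k = max n m"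
  have "norm (green i n) \<le> (\<Sum>j\<le>k. norm (green j n)) + norm (\<pi> n * \<phi> n / E)" for i
  proof (cases "i \<le> k")
    case True
    then have "norm (green i n) \<le> (\<Sum>j\<le>k. norm (green j n))" by (intro member_le_sum) auto
    then show ?thesis using norm_ge_zero[of "\<pi> n * \<phi> n / E"] by linarith
  next
    case False
    then have "green i n = \<pi> n * \<phi> n / E * a ^ (i - m)" by (auto simp: k_def green_def \<psi>_def)
    moreover have "norm (x * a ^ k) \<le> norm x" for x k
      using norm_a by (simp add: norm_mult norm_power mult_left_le power_le_one)
    ultimately have "norm (green i n) \<le> norm (\<pi> n * \<phi> n / E)" by (simp only:)
    moreover have "(\<Sum>j\<le>k. norm (green j n)) \<ge> 0" by (intro sum_nonneg) auto
    ultimately show ?thesis by linarith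
  qed
  then show ?thesis by (auto simp: bounded_iff)
qed

lemma green_unique:
  assumes "\<And>i. backward_at m \<rho> \<theta> (if i = n then 1 else 0) x i" "bounded (range x)"
  shows "x i = green i n"
proof -
  have "backward_at m \<rho> \<theta> 0 (\<lambda>i. x i - green i n) i" for i
    using assms(1)[of i] green_backward[of i n] unfolding backward_at_def by algebra
  moreover have "bounded (range (\<lambda>i. x i - green i n))"
    using assms(2) green_bounded by (rule bounded_minus_comp)
  ultimately have "x i - green i n = 0" by (rule backward_unique[OF \<rho> \<theta>])
  then show ?thesis by simp
qed

section \<open>Closed forms of the Green function\<close>

lemma \<phi>_lower: "i \<le> m \<Longrightarrow> \<phi> i = fact i / of_real \<rho> ^ i * f i"
  and \<psi>_lower: "i \<le> m \<Longrightarrow> \<psi> i = fact i / of_real \<rho> ^ i * (c * (g i + \<kappa> * f i))"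
  and \<pi>_lower: "i \<le> m \<Longrightarrow> \<pi> i = of_real \<rho> ^ i / fact i"
  by (simp_all add: \<phi>_def \<psi>_def \<pi>_def)

text \<open>By the join the upper formulas also hold at m, where the definitions choose the lower
  branch; the ranges that follow overlap at m.\<close>

lemma \<phi>_upper: "m \<le> i \<Longrightarrow> \<phi> i = fact m / of_real \<rho> ^ m / D * (b ^ (i - m) * E - a ^ (i - m) * H)"
  and \<psi>_upper: "m \<le> i \<Longrightarrow> \<psi> i = a ^ (i - m) / E"
  and \<pi>_upper: "m \<le> i \<Longrightarrow> \<pi> i = of_real \<rho> ^ m / fact m * (of_real \<rho> / of_nat m) ^ (i - m)"
  subgoal by (cases "i = m") (simp only: \<phi>_def \<phi>_join(1) order_refl if_True, simp add: \<phi>_def)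
  subgoal by (cases "i = m") (simp only: \<psi>_def \<psi>_join(1) order_refl if_True, simp add: \<psi>_def)
  subgoal by (cases "i = m") (simp_all add: \<pi>_def)
  done

lemma green_low_high:
  assumes "i \<le> m" "m \<le> n"
  shows "green i n = fact i / fact m * of_real \<rho> ^ (m - i) * (f i * A ^ (n - m) / E)"
proof -
  have "green i n = \<pi> n * \<phi> i * \<psi> n" using assms by (simp add: green_def)
  \<comment> \<open>The geometric factor of \<pi> joins the powers of a: (\<rho> / m) a = A.\<close>
  also have "\<dots> = of_real \<rho> ^ m / fact m * (fact i / of_real \<rho> ^ i * f i) * ((of_real \<rho> / of_nat m * a) ^ (n - m) / E)"
    unfolding power_mult_distrib using assms by (simp add: \<phi>_lower \<psi>_upper \<pi>_upper)
  also have "of_real \<rho> ^ m = of_real \<rho> ^ i * (of_real \<rho> ^ (m - i) :: complex)"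
    using assms by (simp flip: power_add)
  finally show ?thesis unfolding a_A using nz by simp
qed

lemma green_low_mid:
  assumes "i \<le> n" "n \<le> m"
  shows "green i n = c * fact i / of_real \<rho> ^ i * (g n + \<kappa> * f n) * f i"
  using assms nz by (simp add: green_def \<phi>_lower \<psi>_lower \<pi>_lower)

lemma green_low_low:
  assumes "n \<le> i" "i \<le> m"
  shows "green i n = c * fact i / of_real \<rho> ^ i * (g i + \<kappa> * f i) * f n"
  using assms nz by (simp add: green_def \<phi>_lower \<psi>_lower \<pi>_lower)

lemma green_high_low:
  assumes "m \<le> i" "n \<le> m"
  shows "green i n = a ^ (i - m) * (f n / E)"
  using assms nz by (simp add: green_def \<phi>_lower \<psi>_upper \<pi>_lower)

lemma divide_E: "d * (x * E - y * H) * (z / E) = d * (x * z - y * z * (H / E))"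
proof -
  have "(x * E) * (z / E) = x * z" using E_nz by simp
  moreover have "(y * H) * (z / E) = y * z * (H / E)" by (simp only: divide_inverse mult_ac)
  ultimately show ?thesis by (simp only: mult.assoc[of d] left_diff_distrib)
qed

lemma green_high_mid:
  assumes "m \<le> n" "n \<le> i"
  shows "green i n = 1 / D * (a ^ (i - n) - A ^ (n - m) * a ^ (i - m) * (H / E))"
proof -
  have "green i n = \<pi> n * \<phi> n * \<psi> i" using assms by (simp add: green_def)
  also have "\<dots> = 1 / D * ((of_real \<rho> / of_nat m * b) ^ (n - m) * E - (of_real \<rho> / of_nat m * a) ^ (n - m) * H) * (a ^ (i - m) / E)"
    unfolding power_mult_distrib using assms nz
    by (simp add: \<phi>_upper \<psi>_upper \<pi>_upper right_diff_distrib mult.assoc)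
  also have "\<dots> = 1 / D * (B ^ (n - m) * a ^ (i - m) - A ^ (n - m) * a ^ (i - m) * (H / E))"
    unfolding a_A b_B by (rule divide_E)
  \<comment> \<open>Since a B = 1, only the distance i - n between starting and target state
    survives.\<close>
  also have "B ^ (n - m) * a ^ (i - m) = (a * B) ^ (n - m) * a ^ (i - n)"
  proof -
    have "i - m = (n - m) + (i - n)" using assms by simp
    then show ?thesis by (simp add: power_add power_mult_distrib)
  qed
  finally show ?thesis by (simp add: aB)
qed

lemma green_high_high:
  assumes "m \<le> i" "i \<le> n"
  shows "green i n = 1 / D * (A ^ (n - i) - a ^ (i - m) * A ^ (n - m) * (H / E))"
proof -
  have "green i n = \<pi> n * \<phi> i * \<psi> n" using assms by (simp add: green_def)
  also have "\<dots> = 1 / D * (b ^ (i - m) * E - a ^ (i - m) * H) * ((of_real \<rho> / of_nat m * a) ^ (n - m) / E)"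
    unfolding power_mult_distrib using assms nz by (simp add: \<phi>_upper \<psi>_upper \<pi>_upper)
  also have "\<dots> = 1 / D * (A ^ (n - m) * b ^ (i - m) - a ^ (i - m) * A ^ (n - m) * (H / E))"
    unfolding a_A divide_E by (simp only: mult.commute)
  also have "A ^ (n - m) * b ^ (i - m) = (A * b) ^ (i - m) * A ^ (n - i)"
  proof -
    have "n - m = (i - m) + (n - i)" using assms by simp
    then show ?thesis by (simp add: power_add power_mult_distrib)
  qed
  finally show ?thesis by (simp add: bA)
qed

end

section \<open>The queue length process\<close>

text \<open>The Markov property with the single past time 0. It speaks of strictly later times, so t
  = 0 is settled by the semigroup being the identity there.\<close>

lemma birth_death_marginal:
  assumes "birth_death_process M N birth death" and start: "AE \<omega> in M. N 0 \<omega> = i"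
  obtains P where "transition_semigroup P" "has_transition_rates P (birth_death_rate birth death)"
    "\<And>n t. t \<ge> 0 \<Longrightarrow> \<P>(\<omega> in M. N t \<omega> = n \<bar> N 0 \<omega> = i) = pmf (P t i) n"
proof -
  obtain P where P: "transition_semigroup P" "has_transition_rates P (birth_death_rate birth death)" "markov_with M N P"
    and M: "prob_space M" and meas: "\<And>t. t \<ge> 0 \<Longrightarrow> N t \<in> M \<rightarrow>\<^sub>M count_space UNIV"
    using assms(1) by (auto simp: birth_death_process_def)
  interpret prob_space M by fact
  have [measurable]: "N 0 \<in> M \<rightarrow>\<^sub>M count_space UNIV" by (rule meas) simp
  have "\<P>(\<omega> in M. N 0 \<omega> = i) = 1"
    using start by (subst prob_Collect_eq_1) auto
  have eq: "\<P>(\<omega> in M. N t \<omega> = n \<bar> N 0 \<omega> = i) = pmf (P t i) n" if "t \<ge> 0" for n t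
  proof (cases "t = 0")
    case True
    have "prob {\<omega> \<in> space M. N 0 \<omega> = n \<and> N 0 \<omega> = i} = 0" if "i \<noteq> n"
    proof -
      have "{\<omega> \<in> space M. N 0 \<omega> = n \<and> N 0 \<omega> = i} = {}" using that by auto
      then show ?thesis by (simp only: measure_empty)
    qed
    then show ?thesis
      using True P(1) \<open>\<P>(\<omega> in M. N 0 \<omega> = i) = 1\<close>
      by (cases "i = n") (simp_all add: cond_prob_def transition_semigroup_def)
  next
    case False
    \<comment> \<open>A time sequence on all naturals is demanded; with k = 0 the times inspected
      are \<tau> 0 = 0 and \<tau> 1 = t.\<close>
    define \<tau> where "\<tau> = (\<lambda>k::nat. if k = 0 then 0 else if k = 1 then t else t + real k)"
    have "\<tau> 0 \<ge> 0" "\<forall>k\<le>0. \<tau> k < \<tau> (Suc k)" using False that by (auto simp: \<tau>_def)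
    with P(3)[unfolded markov_with_def, rule_format, of \<tau> 0 "\<lambda>_. i" n]
    show ?thesis using \<open>\<P>(\<omega> in M. N 0 \<omega> = i) = 1\<close> by (simp add: \<tau>_def)
  qed
  from P(1,2) eq show ?thesis by (rule that)
qed

lemma laplace_transform_cong:
  "(\<And>t. t \<ge> 0 \<Longrightarrow> f t = g t) \<Longrightarrow> laplace_transform f \<theta> = laplace_transform g \<theta>"
  unfolding laplace_transform_def by (intro set_lebesgue_integral_cong) auto

section \<open>The characteristic roots A and B\<close>

text \<open>If |B| = 1, the quadratic would give |m + \<rho> + \<theta>| \<le> m + \<rho>, which is
  false for Re \<theta> > 0. By continuity on the connected half-plane |B| stays on one side of 1,
  and positivity of the root at \<theta> = 1 decides which. Similarly S cannot vanish, since 4 m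
  \<rho> \<le> (m + \<rho>)^2.\<close>

lemma sqrt_branch_root:
  assumes "m \<ge> 1" "\<rho> > 0" "Re \<theta> > 0" and S: "sqrt_branch m \<rho> S"
  defines "A \<equiv> 1 / (2 * of_nat m) * (of_nat m + of_real \<rho> + \<theta> - S \<theta>)"
    and "B \<equiv> 1 / (2 * of_nat m) * (of_nat m + of_real \<rho> + \<theta> + S \<theta>)"
  shows "of_nat m * (A + B) = of_nat m + of_real \<rho> + \<theta>" "of_nat m * (A * B) = of_real \<rho>"
    "S \<theta> = of_nat m * (B - A)" "S \<theta> \<noteq> 0" "norm B \<ge> 1"
proof -
  have m: "of_nat m \<noteq> (0::complex)" "real m > 0" using assms by auto
  \<comment> \<open>B as a function of \<theta>, for the continuity argument.\<close>
  define R where "R = (\<lambda>\<theta>. 1 / (2 * of_nat m) * (of_nat m + of_real \<rho> + \<theta> + S \<theta>))"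
  have sq: "(S \<theta>)\<^sup>2 = (of_nat m + of_real \<rho> + \<theta>)\<^sup>2 - 4 * of_nat m * of_real \<rho>" if "Re \<theta> > 0" for \<theta>
    using S that by (simp add: sqrt_branch_def)
  have big: "norm (of_nat m + of_real \<rho> + \<theta>) > real m + \<rho>" if "Re \<theta> > 0" for \<theta>
    using complex_Re_le_cmod[of "of_nat m + of_real \<rho> + \<theta>"] that by simp
  show "of_nat m * (A + B) = of_nat m + of_real \<rho> + \<theta>" "S \<theta> = of_nat m * (B - A)"
    using m by (simp_all add: A_def B_def field_simps)
  have "4 * of_nat m * (of_nat m * (A * B)) = (of_nat m + of_real \<rho> + \<theta>)\<^sup>2 - (S \<theta>)\<^sup>2"
    using m by (simp add: A_def B_def field_simps power2_eq_square)
  then show "of_nat m * (A * B) = of_real \<rho>"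
    using m unfolding sq[OF assms(3)] by (simp add: power2_eq_square)
  show "S \<theta> \<noteq> 0"
  proof
    assume "S \<theta> = 0"
    then have "(of_nat m + of_real \<rho> + \<theta>)\<^sup>2 = of_real (4 * real m * \<rho>)"
      using sq[OF assms(3)] by simp
    then have "(norm (of_nat m + of_real \<rho> + \<theta>))\<^sup>2 = norm (complex_of_real (4 * real m * \<rho>))"
      by (metis norm_power)
    also have "\<dots> = 4 * real m * \<rho>" using assms by (simp only: norm_of_real) simp
    also have "\<dots> \<le> (real m + \<rho>)\<^sup>2"
      using zero_le_power2[of "real m - \<rho>"] by (simp add: power2_eq_square algebra_simps)
    also have "\<dots> < (norm (of_nat m + of_real \<rho> + \<theta>))\<^sup>2"
      using big[OF assms(3)] assms by (intro power_strict_mono) auto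
    finally show False by simp
  qed
  have not1: "norm (R \<theta>) \<noteq> 1" if "Re \<theta> > 0" for \<theta>
  proof
    assume n1: "norm (R \<theta>) = 1"
    have "of_nat m * (R \<theta>)\<^sup>2 + of_real \<rho> = (of_nat m + of_real \<rho> + \<theta>) * R \<theta>"
    proof -
      have "2 * of_nat m * R \<theta> = of_nat m + of_real \<rho> + \<theta> + S \<theta>" using m by (simp add: R_def)
      then have "4 * of_nat m * (of_nat m * (R \<theta>)\<^sup>2 + of_real \<rho>) = 4 * of_nat m * ((of_nat m + of_real \<rho> + \<theta>) * R \<theta>)"
        using sq[OF that] by algebra
      then show ?thesis using m by simp
    qed
    then have "norm (of_nat m + of_real \<rho> + \<theta>) * norm (R \<theta>) = norm (of_nat m * (R \<theta>)\<^sup>2 + of_real \<rho>)"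
      by (metis norm_mult)
    also have "\<dots> \<le> norm (of_nat m * (R \<theta>)\<^sup>2) + norm (complex_of_real \<rho>)" by (rule norm_triangle_ineq)
    also have "\<dots> = real m + \<rho>" using n1 assms by (simp add: norm_mult norm_power)
    finally show False using big[OF that] n1 by simp
  qed
  let ?V = "{\<theta>. Re \<theta> > 0}"
  have "connected ((\<lambda>\<theta>. norm (R \<theta>)) ` ?V)"
  proof (rule connected_continuous_image)
    have "continuous_on ?V S"
      using S by (auto simp: sqrt_branch_def intro: analytic_imp_holomorphic holomorphic_on_imp_continuous_on)
    then show "continuous_on ?V (\<lambda>\<theta>. norm (R \<theta>))" unfolding R_def by (intro continuous_intros)
    show "connected ?V" by (intro convex_connected convex_halfspace_Re_gt)
  qed
  then have int: "is_interval ((\<lambda>\<theta>. norm (R \<theta>)) ` ?V)" by (simp add: is_interval_connected_1)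
  have "norm (R 1) \<ge> 1"
  proof -
    obtain y where y: "y > 0" "S 1 = of_real y" using S unfolding sqrt_branch_def by (metis of_real_1 zero_less_one)
    have "complex_of_real (y\<^sup>2) = of_real ((real m + \<rho> + 1)\<^sup>2 - 4 * real m * \<rho>)"
      using sq[of 1] y by simp
    then have "y\<^sup>2 = (real m + \<rho> + 1)\<^sup>2 - 4 * real m * \<rho>" by (simp only: of_real_eq_iff)
    \<comment> \<open>Written this way the square shows y \<ge> m - \<rho> - 1, which is R 1 \<ge>
      1.\<close>
    then have "y\<^sup>2 = (real m - \<rho> - 1)\<^sup>2 + 4 * real m" by (simp add: power2_eq_square algebra_simps)
    then have "(real m - \<rho> - 1)\<^sup>2 \<le> y\<^sup>2" by simp
    then have le: "real m - \<rho> - 1 \<le> y" using y power2_le_imp_le by (metis less_imp_le)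
    have "R 1 = of_real ((real m + \<rho> + 1 + y) / (2 * real m))"
      by (simp add: R_def y)
    then have R1: "norm (R 1) = (real m + \<rho> + 1 + y) / (2 * real m)"
      using y assms by (simp only: norm_of_real) simp
    show ?thesis unfolding R1 using m le by (simp add: le_divide_eq)
  qed
  show "norm B \<ge> 1"
  proof (rule ccontr)
    assume "\<not> norm B \<ge> 1"
    then have "norm (R \<theta>) \<le> 1" by (simp add: R_def B_def)
    then have "1 \<in> (\<lambda>\<theta>. norm (R \<theta>)) ` ?V"
      using int \<open>norm (R 1) \<ge> 1\<close> assms(3) unfolding is_interval_1 by (metis (mono_tags, lifting) imageI mem_Collect_eq one_complex.sel(1) zero_less_one)
    then show False using not1 by auto
  qed
qed

text \<open>A row of rates lives on i and its neighbours and sums to 0, so these states serve as K;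
  state 0 has one neighbour fewer.\<close>

lemma birth_death_laplace_backward:
  fixes P :: "real \<Rightarrow> nat \<Rightarrow> nat pmf"
  assumes sg: "transition_semigroup P"
    and r: "has_transition_rates P (birth_death_rate (\<lambda>n. \<rho>) (\<lambda>n. real (min n m)))"
    and \<theta>: "Re \<theta> > 0"
  shows "backward_at m \<rho> \<theta> (if i = n then 1 else 0) (\<lambda>i. laplace_transform (\<lambda>t. pmf (P t i) n) \<theta>) i"
proof -
  let ?q = "birth_death_rate (\<lambda>n. \<rho>) (\<lambda>n. real (min n m))"
  let ?U = "\<lambda>i. laplace_transform (\<lambda>t. pmf (P t i) n) \<theta>"
  show ?thesis
  proof (cases "i = 0")
    case True
    have "\<theta> * ?U i = (if i = n then 1 else 0) + (\<Sum>k\<in>{0, 1}. of_real (?q i k) * ?U k)"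
      by (rule laplace_backward[OF sg r _ _ _ \<theta>]) (auto simp: True birth_death_rate_def)
    then show ?thesis using True by (simp add: backward_at_def birth_death_rate_def algebra_simps)
  next
    case False
    then obtain j where j: "i = Suc j" using not0_implies_Suc by auto
    have "\<theta> * ?U i = (if i = n then 1 else 0) + (\<Sum>k\<in>{j, Suc j, Suc (Suc j)}. of_real (?q i k) * ?U k)"
      by (rule laplace_backward[OF sg r _ _ _ \<theta>]) (auto simp: j birth_death_rate_def)
    then show ?thesis by (simp add: backward_at_def birth_death_rate_def j algebra_simps)
  qed
qed

lemma laplace_pmf_bounded:
  assumes sg: "transition_semigroup P" and r: "has_transition_rates P q" and \<theta>: "Re \<theta> > 0"
  shows "bounded (range (\<lambda>i. laplace_transform (\<lambda>t. pmf (P t i) n) \<theta>))"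
proof -
  have "norm (laplace_transform (\<lambda>t. pmf (P t i) n) \<theta>) \<le> 1 / Re \<theta>" for i
  proof (rule laplace_set_integrable(2)[OF \<theta>])
    show "set_borel_measurable borel {0..} (\<lambda>t. pmf (P t i) n)"
      unfolding set_borel_measurable_def
      by (intro borel_measurable_continuous_on_indicator transition_continuous[OF sg r]) auto
  qed (auto simp: pmf_le_1)
  then show ?thesis by (auto simp: bounded_iff)
qed

theorem corollary3:
  fixes m n0 :: nat and \<rho> r \<epsilon> :: real and \<theta> :: complex
    and M :: "'w measure" and N :: "real \<Rightarrow> 'w \<Rightarrow> nat"
    and p :: "nat \<Rightarrow> real \<Rightarrow> real" and P :: "nat \<Rightarrow> complex"
    and S :: "complex \<Rightarrow> complex" and \<gamma> :: "real \<Rightarrow> complex"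
    and A B D :: complex and F G :: "int \<Rightarrow> complex"
  assumes m: "m \<ge> 1" and rho: "\<rho> > 0" and theta: "Re \<theta> > 0"
    and process: "birth_death_process M N (\<lambda>n. \<rho>) (\<lambda>n. real (min n m))"
    and start: "AE \<omega> in M. N 0 \<omega> = n0"
    and p_def: "p = (\<lambda>n t. \<P>(\<omega> in M. N t \<omega> = n \<bar> N 0 \<omega> = n0))"
    and P_def: "P = (\<lambda>n. laplace_transform (p n) \<theta>)"
    and branch: "sqrt_branch m \<rho> S"
    and D_def: "D = S \<theta>"
    and A_def: "A = 1 / (2 * of_nat m) * (of_nat m + of_real \<rho> + \<theta> - D)"
    and B_def: "B = 1 / (2 * of_nat m) * (of_nat m + of_real \<rho> + \<theta> + D)"
    and circle: "0 < r" "r < 1"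
    and contour: "hankel_contour \<epsilon> \<gamma>"
    and F_def: "F = special_F r \<rho> \<theta>"
    and G_def: "G = special_G \<gamma> \<rho> \<theta>"
  shows "(n0 \<le> m \<longrightarrow>
      (\<forall>n\<ge>m. P n =
         fact n0 / fact m * of_real \<rho> ^ (m - n0) *
         (F n0 * A ^ (n - m) / ((of_nat m + 1) * F (m + 1) - A * of_nat m * F m))) \<and>
      (\<forall>n. n0 \<le> n \<and> n \<le> m \<longrightarrow> P n =
         fact n0 * Gamma \<theta> * exp (- of_real \<rho>) / of_real \<rho> powr (of_nat n0 + \<theta>) *
         (G n + (of_nat m * A * G m - (of_nat m + 1) * G (m + 1)) /
                ((of_nat m + 1) * F (m + 1) - of_nat m * A * F m) * F n) * F n0) \<and>
      (\<forall>n\<le>n0. P n =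
         fact n0 * Gamma \<theta> * exp (- of_real \<rho>) / of_real \<rho> powr (of_nat n0 + \<theta>) *
         (G n0 + (of_nat m * A * G m - (of_nat m + 1) * G (m + 1)) /
                 ((of_nat m + 1) * F (m + 1) - of_nat m * A * F m) * F n0) * F n)) \<and>
    (n0 \<ge> m \<longrightarrow>
      (\<forall>n\<le>m. P n =
         B powi (int m - int n0) *
         (F n / ((of_nat m + 1) * F (m + 1) - A * of_nat m * F m))) \<and>
      (\<forall>n. m \<le> n \<and> n \<le> n0 \<longrightarrow> P n =
         1 / D * (B powi (int n - int n0) +
           A ^ (n - m) * B powi (int m - int n0) *
           (((of_nat m + 1) * F (m + 1) - B * of_nat m * F m) /
            (A * of_nat m * F m - (of_nat m + 1) * F (m + 1))))) \<and>
      (\<forall>n\<ge>n0. P n =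
         1 / D * (A ^ (n - n0) +
           B powi (int m - int n0) * A ^ (n - m) *
           (((of_nat m + 1) * F (m + 1) - B * of_nat m * F m) /
            (A * of_nat m * F m - (of_nat m + 1) * F (m + 1))))))"
proof -
  \<comment> \<open>The reciprocal of \<rho> G_(-1), which by the recurrences at n = 0 is the
    Casoratian F_1 G_0 - G_1 F_0.\<close>
  define c where "c = Gamma \<theta> * exp (- of_real \<rho>) / of_real \<rho> powr \<theta>"
  note root = sqrt_branch_root[OF m rho theta branch, folded D_def, folded A_def B_def]
  have rho_nz: "complex_of_real \<rho> \<noteq> 0" "complex_of_real \<rho> powr z \<noteq> 0" for z using rho by auto
  have F_rec: "(of_nat n + 1) * F (int n + 1) = (of_real \<rho> + of_nat n + \<theta>) * F (int n) - of_real \<rho> * F (int n - 1)" for n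
    unfolding F_def by (rule special_F_recurrence[OF circle])
  have G_rec: "(of_nat n + 1) * G (int n + 1) = (of_real \<rho> + of_nat n + \<theta>) * G (int n) - of_real \<rho> * G (int n - 1)" for n
    unfolding G_def by (rule special_G_recurrence[OF contour rho theta])
  have F_init: "F (- 1) = 0" "F 0 = 1" unfolding F_def by (rule special_F_initial[OF circle])+
  have F1: "F 1 = of_real \<rho> + \<theta>" using F_rec[of 0] F_init by simp
  have "rGamma \<theta> \<noteq> 0" using theta by (auto simp: rGamma_eq_zero_iff elim!: nonpos_Ints_cases)
  then have cas: "c * (of_real \<rho> * G (- 1)) = 1"
    unfolding G_def special_G_minus1[OF contour rho theta] c_def
    using rho_nz by (simp add: Gamma_def powr_diff exp_minus field_simps)
  interpret mm_m_resolvent m \<rho> \<theta> A B D c "\<lambda>n. F (int n)" "\<lambda>n. G (int n)"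
  proof
    have "G 1 = (of_real \<rho> + \<theta>) * G 0 - of_real \<rho> * G (- 1)" using G_rec[of 0] by simp
    then have "c * (F 1 * G 0 - G 1 * F 0) = 1" using cas F1 F_init(2) by algebra
    then show "c * (F (int 1) * G (int 0) - G (int 1) * F (int 0)) = 1" by simp
    show "(of_nat n + 1) * F (int (Suc n)) = (of_real \<rho> + of_nat n + \<theta>) * F (int n) - of_real \<rho> * F (int (n - 1))"
      "(of_nat n + 1) * G (int (Suc n)) = (of_real \<rho> + of_nat n + \<theta>) * G (int n) - of_real \<rho> * G (int (n - 1))"
      if "n > 0" for n
      using F_rec[of n] G_rec[of n] that by (simp_all add: of_nat_diff add.commute)
  qed (use m rho theta F_init F1 root in auto)
  \<comment> \<open>Q has a row for every starting state, which closes the backward system; the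
    process provides the row n0.\<close>
  obtain Q where Q: "transition_semigroup Q"
      "has_transition_rates Q (birth_death_rate (\<lambda>n. \<rho>) (\<lambda>n. real (min n m)))"
    and marg: "\<And>n t. t \<ge> 0 \<Longrightarrow> \<P>(\<omega> in M. N t \<omega> = n \<bar> N 0 \<omega> = n0) = pmf (Q t n0) n"
    using birth_death_marginal[OF process start] by blast
  have P: "P n = green n0 n" for n
  proof -
    have "P n = laplace_transform (\<lambda>t. pmf (Q t n0) n) \<theta>"
      unfolding P_def p_def by (rule laplace_transform_cong) (rule marg)
    also have "\<dots> = green n0 n"
      by (rule green_unique[where x = "\<lambda>i. laplace_transform (\<lambda>t. pmf (Q t i) n) \<theta>"])
         (intro birth_death_laplace_backward[OF Q theta] laplace_pmf_bounded[OF Q theta])+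
    finally show ?thesis .
  qed
  have E': "(of_nat m + 1) * F (m + 1) - A * of_nat m * F m = E"
      "(of_nat m + 1) * F (m + 1) - of_nat m * A * F m = E"
      "A * of_nat m * F m - (of_nat m + 1) * F (m + 1) = - E"
    and H': "(of_nat m + 1) * F (m + 1) - B * of_nat m * F m = H"
    and \<kappa>': "(of_nat m * A * G m - (of_nat m + 1) * G (m + 1)) / E = \<kappa>"
    by (simp_all add: E_def H_def \<kappa>_def add.commute mult.commute)
  have pref: "fact n0 * Gamma \<theta> * exp (- of_real \<rho>) / of_real \<rho> powr (of_nat n0 + \<theta>) = c * fact n0 / of_real \<rho> ^ n0"
    using rho_nz by (simp add: c_def powr_add powr_nat' field_simps)
  \<comment> \<open>The exponents of B in the statement are nonpositive integers, so they become
    natural powers of a = 1 / B.\<close>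
  have powi: "B powi (int i - int j) = a ^ (j - i)" if "i \<le> j" for i j
    using that inverse_B by (cases "i = j") (auto simp: power_int_def nat_diff_distrib')
  show ?thesis
    unfolding P E' H' \<kappa>' pref
    by (auto simp: green_low_high green_low_mid green_low_low green_high_low green_high_mid green_high_high powi)
qed

end
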